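(* Let $\lambda$ be an $(n|m)$-hook partition and let $\mathcal B$ be a Borel subalgebra of $\mathfrak{osp}(2m+1|2n)$ with associated permutations $s,t$, signs $\xi_i,\eta_j$ and block Frobenius coordinates $(p_i|q_j)$ of $\lambda$. Then the $\mathcal B$-highest weight of the simple $\mathfrak{osp}(2m+1|2n)$-module $L'(\mathfrak{osp}(2m+1|2n),\lambda^\#)$ is $$\lambda^{\mathcal B}:=\sum_{i=1}^n\xi_ip_i\,\delta_{s(i)}+\sum_{j=1}^m\eta_jq_j\,\bar\epsilon_{t(j)}.$$
   Context: Let $m,n\ge1$. The weights of the natural $\mathfrak{osp}(2m+1|2n)$-module $\mathbb C^{2n|2m+1}$ are denoted $\pm\delta_i,0,\pm\bar\epsilon_j$ ($1\le i\le n$, $1\le j\le m$), where $\pm\delta_i$ belong to the $2n$-dimensional symplectic part and $0,\pm\bar\epsilon_j$ to the $(2m+1)$-dimensional orthogonal part. Borel subalgebras contain the fixed standard Cartan subalgebra. The standard Borel $\mathcal B^{\mathrm{st}}$ has simple roots $\delta_1-\delta_2,\dots,\delta_{n-1}-\delta_n,\ \delta_n-\bar\epsilon_1,\ \bar\epsilon_1-\bar\epsilon_2,\dots,\bar\epsilon_{m-1}-\bar\epsilon_m,\ \bar\epsilon_m$. A partition $\lambda=(\lambda_1,\lambda_2,\dots)$ is an $(n|m)$-hook partition if $\lambda_{n+1}\le m$. Then $\lambda^\#=(\lambda_1,\dots,\lambda_n,\nu_1,\dots,\nu_m)$, where $(\nu_1,\dots,\nu_m)$ is the conjugate partition of $(\lambda_{n+1},\lambda_{n+2},\dots)$;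 it is identified with the weight $\sum_i\lambda_i\delta_i+\sum_j\nu_j\bar\epsilon_j$. $L'(\mathfrak{osp}(2m+1|2n),\lambda^\#)$ is the irreducible module of highest weight $\lambda^\#$ with respect to $\mathcal B^{\mathrm{st}}$ (it is finite dimensional). An arbitrary Borel subalgebra $\mathcal B$ is encoded by a sequence $f_1,\dots,f_{m+n}$ whose entries are, in some interleaved order, $\xi_1\delta_{s(1)},\dots,\xi_n\delta_{s(n)}$ (appearing in this relative order) and $\eta_1\bar\epsilon_{t(1)},\dots,\eta_m\bar\epsilon_{t(m)}$ (appearing in this relative order), where $s$ is a permutation of $\{1,\dots,n\}$, $t$ a permutation of $\{1,\dots,m\}$, and $\xi_i,\eta_j\in\{\pm1\}$; the simple roots of $\mathcal B$ are $f_k-f_{k+1}$ ($1\le k<m+n$) and $f_{m+n}$. Block Frobenius coordinates $(p_i|q_j)$ of $\lambda$ associated to $\mathcal B$: $p_i=\max\{\lambda_i-e,0\}$, where $e$ is the number of $\bar\epsilon$-entries of the sequence preceding its $i$-th $\delta$-entry ($1\le i\le n$); $q_j=\max\{\lambda'_j-d,0\}$, where $d$ is the number of $\delta$-entries preceding the $j$-th $\bar\epsilon$-entry ($1\le j\le m$), and $\lambda'$ is the conjugate partition. *)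

theory Defs
  imports Complex_Main "HOL-Library.Function_Algebras" "HOL-Combinatorics.Permutations"
begin

section \<open>The Lie superalgebra $osp(2m+1|2n)$\<close>

text \<open>
  \<open>Del i\<close> and \<open>Eps j\<close> index the weights $\delta_i$ and $\bar\epsilon_j$. The labels
  \<open>Pos x\<close>, \<open>Neg x\<close>, \<open>Zero\<close> are the weights of the natural module and at the same time index its
  weight basis. Matrices are families of entries (row, column) vanishing outside the
  labels of the given \<open>n\<close> and \<open>m\<close>; sums and differences of matrices and of weights are the pointwise
  ones, but the pointwise product of functions is never used.
\<close>

datatype axis = Del nat | Eps nat

datatype label = Pos axis | Neg axis | Zero

type_synonym mat = "label \<Rightarrow> label \<Rightarrow> complex"

type_synonym weight = "axis \<Rightarrow> complex"

definition axes :: "nat \<Rightarrow> nat \<Rightarrow> axis set" where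
  "axes n m = Del ` {1..n} \<union> Eps ` {1..m}"

definition labels :: "nat \<Rightarrow> nat \<Rightarrow> label set" where
  "labels n m = Pos ` axes n m \<union> Neg ` axes n m \<union> {Zero}"

text \<open>
  In $C^{2n|2m+1}$ the symplectic part is even and the orthogonal part is odd, so the even
  nondegenerate form defining the superalgebra is skew-supersymmetric: skew-symmetric on the
  symplectic part and symmetric on the orthogonal part.
\<close>

fun parity :: "label \<Rightarrow> nat" where
  "parity (Pos (Del i)) = 0"
| "parity (Neg (Del i)) = 0"
| "parity (Pos (Eps j)) = 1"
| "parity (Neg (Eps j)) = 1"
| "parity Zero = 1"

fun form :: "label \<Rightarrow> label \<Rightarrow> complex" where
  "form (Pos (Del i)) b = (if b = Neg (Del i) then 1 else 0)"
| "form (Neg (Del i)) b = (if b = Pos (Del i) then -1 else 0)"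
| "form (Pos (Eps j)) b = (if b = Neg (Eps j) then 1 else 0)"
| "form (Neg (Eps j)) b = (if b = Pos (Eps j) then 1 else 0)"
| "form Zero b = (if b = Zero then 1 else 0)"

definition mat_mult :: "nat \<Rightarrow> nat \<Rightarrow> mat \<Rightarrow> mat \<Rightarrow> mat" where
  "mat_mult n m X Y = (\<lambda>a b. \<Sum>c\<in>labels n m. X a c * Y c b)"

definition mat_scale :: "complex \<Rightarrow> mat \<Rightarrow> mat" where
  "mat_scale c X = (\<lambda>a b. c * X a b)"

text \<open>The bracket of \<open>X\<close> of parity \<open>p\<close> and \<open>Y\<close> of parity \<open>q\<close>.\<close>

definition superbracket :: "nat \<Rightarrow> nat \<Rightarrow> nat \<Rightarrow> nat \<Rightarrow> mat \<Rightarrow> mat \<Rightarrow> mat" where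
  "superbracket n m p q X Y =
     mat_mult n m X Y - mat_scale ((-1) ^ (p * q)) (mat_mult n m Y X)"

definition gl_part :: "nat \<Rightarrow> nat \<Rightarrow> nat \<Rightarrow> mat set" where
  "gl_part n m p =
     {X. \<forall>a b. X a b \<noteq> 0 \<longrightarrow>
           a \<in> labels n m \<and> b \<in> labels n m \<and> (parity a + parity b) mod 2 = p}"

text \<open>
  The condition is $(X v, w) + (-1)^{|X||v|} (v, X w) = 0$ evaluated at the basis vectors
  $v = e_a$, $w = e_b$, where $X e_a = \sum_c X_{ca} e_c$.
\<close>

definition osp_part :: "nat \<Rightarrow> nat \<Rightarrow> nat \<Rightarrow> mat set" where
  "osp_part n m p =
     {X \<in> gl_part n m p. \<forall>a\<in>labels n m. \<forall>b\<in>labels n m.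
        (\<Sum>c\<in>labels n m. X c a * form c b)
        + (-1) ^ (p * parity a) * (\<Sum>c\<in>labels n m. form a c * X c b) = 0}"

definition osp :: "nat \<Rightarrow> nat \<Rightarrow> mat set" where
  "osp n m = {X + Y | X Y. X \<in> osp_part n m 0 \<and> Y \<in> osp_part n m 1}"

definition cartan :: "nat \<Rightarrow> nat \<Rightarrow> mat set" where
  "cartan n m = {H \<in> osp n m. \<forall>a b. a \<noteq> b \<longrightarrow> H a b = 0}"


section \<open>Weights, roots and Borel subalgebras\<close>

text \<open>
  A weight, i.e. a linear functional on the Cartan subalgebra, is given by its coefficients in the
  basis $\delta_i$, $\bar\epsilon_j$; the basis element belonging to \<open>x\<close> sends \<open>H\<close> to the
  eigenvalue of \<open>H\<close> on the basis vector labelled \<open>Pos x\<close>.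
\<close>

definition weights :: "nat \<Rightarrow> nat \<Rightarrow> weight set" where
  "weights n m = {\<mu>. \<forall>x. x \<notin> axes n m \<longrightarrow> \<mu> x = 0}"

definition weight_eval :: "nat \<Rightarrow> nat \<Rightarrow> weight \<Rightarrow> mat \<Rightarrow> complex" where
  "weight_eval n m \<mu> H = (\<Sum>x\<in>axes n m. \<mu> x * H (Pos x) (Pos x))"

definition weight_scale :: "complex \<Rightarrow> weight \<Rightarrow> weight" where
  "weight_scale c \<mu> = (\<lambda>x. c * \<mu> x)"

definition delta :: "nat \<Rightarrow> weight" where
  "delta i = (\<lambda>x. if x = Del i then 1 else 0)"

definition eps :: "nat \<Rightarrow> weight" where
  "eps j = (\<lambda>x. if x = Eps j then 1 else 0)"

definition root_space :: "nat \<Rightarrow> nat \<Rightarrow> weight \<Rightarrow> mat set" where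
  "root_space n m \<alpha> =
     {X \<in> osp n m. \<forall>H\<in>cartan n m.
        mat_mult n m H X - mat_mult n m X H = mat_scale (weight_eval n m \<alpha> H) X}"

definition roots :: "nat \<Rightarrow> nat \<Rightarrow> weight set" where
  "roots n m = {\<alpha> \<in> weights n m. \<alpha> \<noteq> 0 \<and> root_space n m \<alpha> \<noteq> {0}}"

text \<open>
  Positive systems are cut out by the elements of the Cartan subalgebra on which all roots take
  nonzero real values.
\<close>

definition positive_system :: "nat \<Rightarrow> nat \<Rightarrow> weight set \<Rightarrow> bool" where
  "positive_system n m P \<longleftrightarrow>
     (\<exists>x\<in>cartan n m.
        (\<forall>\<alpha>\<in>roots n m. weight_eval n m \<alpha> x \<in> \<real> \<and> weight_eval n m \<alpha> x \<noteq> 0) \<and>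
        P = {\<alpha> \<in> roots n m. Re (weight_eval n m \<alpha> x) > 0})"

definition borel_subalgebra :: "nat \<Rightarrow> nat \<Rightarrow> mat set \<Rightarrow> bool" where
  "borel_subalgebra n m B \<longleftrightarrow>
     (\<exists>P. positive_system n m P \<and>
        B = {H + (\<Sum>\<alpha>\<in>P. Y \<alpha>) | H Y. H \<in> cartan n m \<and> (\<forall>\<alpha>\<in>P. Y \<alpha> \<in> root_space n m \<alpha>)})"

definition positive_roots :: "nat \<Rightarrow> nat \<Rightarrow> mat set \<Rightarrow> weight set" where
  "positive_roots n m B = {\<alpha> \<in> roots n m. root_space n m \<alpha> \<subseteq> B}"

definition simple_roots :: "nat \<Rightarrow> nat \<Rightarrow> mat set \<Rightarrow> weight set" where
  "simple_roots n m B =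
     {\<alpha> \<in> positive_roots n m B.
        \<not> (\<exists>\<beta>\<in>positive_roots n m B. \<exists>\<gamma>\<in>positive_roots n m B. \<alpha> = \<beta> + \<gamma>)}"

definition standard_borel :: "nat \<Rightarrow> nat \<Rightarrow> mat set \<Rightarrow> bool" where
  "standard_borel n m B \<longleftrightarrow> borel_subalgebra n m B \<and>
     simple_roots n m B =
       {delta i - delta (i + 1) | i. 1 \<le> i \<and> i < n} \<union> {delta n - eps 1} \<union>
       {eps j - eps (j + 1) | j. 1 \<le> j \<and> j < m} \<union> {eps m}"

text \<open>
  The sequence \<open>f\<close> attached to a Borel subalgebra: \<open>u i\<close> is the position of the \<open>i\<close>-th
  $\delta$-entry and \<open>w j\<close> the position of the \<open>j\<close>-th $\bar\epsilon$-entry.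
\<close>

definition borel_sequence ::
  "nat \<Rightarrow> nat \<Rightarrow> mat set \<Rightarrow> (nat \<Rightarrow> weight) \<Rightarrow> (nat \<Rightarrow> nat) \<Rightarrow> (nat \<Rightarrow> nat) \<Rightarrow>
   (nat \<Rightarrow> nat) \<Rightarrow> (nat \<Rightarrow> nat) \<Rightarrow> (nat \<Rightarrow> int) \<Rightarrow> (nat \<Rightarrow> int) \<Rightarrow> bool" where
  "borel_sequence n m B f u w s t \<xi> \<eta> \<longleftrightarrow>
     strict_mono_on {1..n} u \<and> strict_mono_on {1..m} w \<and>
     u ` {1..n} \<inter> w ` {1..m} = {} \<and> u ` {1..n} \<union> w ` {1..m} = {1..m + n} \<and>
     s permutes {1..n} \<and> t permutes {1..m} \<and>
     (\<forall>i\<in>{1..n}. \<xi> i \<in> {1, -1}) \<and> (\<forall>j\<in>{1..m}. \<eta> j \<in> {1, -1}) \<and>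
     (\<forall>i\<in>{1..n}. f (u i) = weight_scale (of_int (\<xi> i)) (delta (s i))) \<and>
     (\<forall>j\<in>{1..m}. f (w j) = weight_scale (of_int (\<eta> j)) (eps (t j))) \<and>
     simple_roots n m B = {f k - f (k + 1) | k. 1 \<le> k \<and> k < m + n} \<union> {f (m + n)}"


section \<open>Modules and highest weights\<close>

text \<open>
  The underlying space is the whole type \<open>'v\<close>; \<open>V 0\<close> and \<open>V 1\<close> are its even and odd parts.
\<close>

locale osp_module = vector_space scale
  for scale :: "complex \<Rightarrow> 'v::ab_group_add \<Rightarrow> 'v" +
  fixes n m :: nat and V :: "nat \<Rightarrow> 'v set" and act :: "mat \<Rightarrow> 'v \<Rightarrow> 'v"
  assumes subspace_even: "subspace (V 0)" and subspace_odd: "subspace (V 1)"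
    and grading_disjoint: "V 0 \<inter> V 1 = {0}"
    and grading_total: "\<And>v. \<exists>a\<in>V 0. \<exists>b\<in>V 1. v = a + b"
    and act_linear: "\<And>X. X \<in> osp n m \<Longrightarrow> Vector_Spaces.linear scale scale (act X)"
    and act_add: "\<And>X Y v. X \<in> osp n m \<Longrightarrow> Y \<in> osp n m \<Longrightarrow> act (X + Y) v = act X v + act Y v"
    and act_scale: "\<And>c X v. X \<in> osp n m \<Longrightarrow> act (mat_scale c X) v = scale c (act X v)"
    and act_parity: "\<And>p q X v. p \<in> {0, 1} \<Longrightarrow> q \<in> {0, 1} \<Longrightarrow>
           X \<in> osp_part n m p \<Longrightarrow> v \<in> V q \<Longrightarrow> act X v \<in> V ((p + q) mod 2)"
    and act_bracket: "\<And>p q X Y v. p \<in> {0, 1} \<Longrightarrow> q \<in> {0, 1} \<Longrightarrow>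
           X \<in> osp_part n m p \<Longrightarrow> Y \<in> osp_part n m q \<Longrightarrow>
           act (superbracket n m p q X Y) v
             = act X (act Y v) - scale ((-1) ^ (p * q)) (act Y (act X v))"

text \<open>Submodules of a module over a Lie superalgebra are graded.\<close>

definition submodule ::
  "(complex \<Rightarrow> 'v \<Rightarrow> 'v) \<Rightarrow> nat \<Rightarrow> nat \<Rightarrow> (nat \<Rightarrow> 'v set) \<Rightarrow> (mat \<Rightarrow> 'v \<Rightarrow> 'v) \<Rightarrow>
   ('v::ab_group_add) set \<Rightarrow> bool" where
  "submodule scale n m V act W \<longleftrightarrow>
     module.subspace scale W \<and>
     (\<forall>v\<in>W. \<exists>a\<in>W \<inter> V 0. \<exists>b\<in>W \<inter> V 1. v = a + b) \<and>
     (\<forall>X\<in>osp n m. \<forall>v\<in>W. act X v \<in> W)"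

definition irreducible_module ::
  "(complex \<Rightarrow> 'v::ab_group_add \<Rightarrow> 'v) \<Rightarrow> nat \<Rightarrow> nat \<Rightarrow> (nat \<Rightarrow> 'v set) \<Rightarrow> (mat \<Rightarrow> 'v \<Rightarrow> 'v) \<Rightarrow>
   bool" where
  "irreducible_module scale n m V act \<longleftrightarrow>
     osp_module scale n m V act \<and> (\<exists>v::'v. v \<noteq> 0) \<and>
     (\<forall>W. submodule scale n m V act W \<longrightarrow> W = {0} \<or> W = UNIV)"

text \<open>
  Only applied to irreducible modules, in which every nonzero singular vector generates.
\<close>

definition highest_weight ::
  "(complex \<Rightarrow> 'v::ab_group_add \<Rightarrow> 'v) \<Rightarrow> nat \<Rightarrow> nat \<Rightarrow> (mat \<Rightarrow> 'v \<Rightarrow> 'v) \<Rightarrow> mat set \<Rightarrow> weight \<Rightarrow>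
   bool" where
  "highest_weight scale n m act B \<mu> \<longleftrightarrow> \<mu> \<in> weights n m \<and>
     (\<exists>v. v \<noteq> 0 \<and>
        (\<forall>H\<in>cartan n m. act H v = scale (weight_eval n m \<mu> H) v) \<and>
        (\<forall>\<alpha>\<in>positive_roots n m B. \<forall>X\<in>root_space n m \<alpha>. act X v = 0))"


section \<open>Hook partitions and block Frobenius coordinates\<close>

text \<open>Partitions are sequences indexed from \<open>1\<close>; the value at \<open>0\<close> is irrelevant.\<close>

definition partition :: "(nat \<Rightarrow> nat) \<Rightarrow> bool" where
  "partition l \<longleftrightarrow> (\<forall>i\<ge>1. l (i + 1) \<le> l i) \<and> finite {i. 1 \<le> i \<and> l i \<noteq> 0}"

definition conjugate :: "(nat \<Rightarrow> nat) \<Rightarrow> nat \<Rightarrow> nat" where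
  "conjugate l j = card {i. 1 \<le> i \<and> j \<le> l i}"

definition hook_partition :: "nat \<Rightarrow> nat \<Rightarrow> (nat \<Rightarrow> nat) \<Rightarrow> bool" where
  "hook_partition n m l \<longleftrightarrow> partition l \<and> l (n + 1) \<le> m"

definition hook_weight :: "nat \<Rightarrow> nat \<Rightarrow> (nat \<Rightarrow> nat) \<Rightarrow> weight" where
  "hook_weight n m l =
     (\<Sum>i = 1..n. weight_scale (of_nat (l i)) (delta i)) +
     (\<Sum>j = 1..m. weight_scale (of_nat (conjugate (\<lambda>k. l (n + k)) j)) (eps j))"

definition frob_p :: "nat \<Rightarrow> (nat \<Rightarrow> nat) \<Rightarrow> (nat \<Rightarrow> nat) \<Rightarrow> (nat \<Rightarrow> nat) \<Rightarrow> nat \<Rightarrow> int" where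
  "frob_p m u w l i = max (int (l i) - int (card {j \<in> {1..m}. w j < u i})) 0"

definition frob_q :: "nat \<Rightarrow> (nat \<Rightarrow> nat) \<Rightarrow> (nat \<Rightarrow> nat) \<Rightarrow> (nat \<Rightarrow> nat) \<Rightarrow> nat \<Rightarrow> int" where
  "frob_q n u w l j = max (int (conjugate l j) - int (card {i \<in> {1..n}. u i < w j})) 0"

definition frob_weight ::
  "nat \<Rightarrow> nat \<Rightarrow> (nat \<Rightarrow> nat) \<Rightarrow> (nat \<Rightarrow> nat) \<Rightarrow> (nat \<Rightarrow> nat) \<Rightarrow> (nat \<Rightarrow> nat) \<Rightarrow>
   (nat \<Rightarrow> int) \<Rightarrow> (nat \<Rightarrow> int) \<Rightarrow> (nat \<Rightarrow> nat) \<Rightarrow> weight" where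
  "frob_weight n m u w s t \<xi> \<eta> l =
     (\<Sum>i = 1..n. weight_scale (of_int (\<xi> i * frob_p m u w l i)) (delta (s i))) +
     (\<Sum>j = 1..m. weight_scale (of_int (\<eta> j * frob_q n u w l j)) (eps (t j)))"

end

theory Submission
  imports Defs
begin

text \<open>
  Any two Borel subalgebras containing the Cartan subalgebra are connected by a chain in which each
  step exchanges two adjacent entries of the sequence \<open>f\<close> or changes the sign of its last entry, so
  it suffices to follow the highest weight through one such step, i.e. through the reflection in a
  simple root \<open>\<alpha>\<close>, which may be even, odd isotropic or odd non-isotropic. If \<open>v\<close> is a highest weight
  vector, \<open>E\<close>, \<open>F\<close> are root vectors for \<open>\<alpha>\<close>, \<open>-\<alpha>\<close> and \<open>E F\<^sup>k v = c\<^sub>k F\<^sup>k\<^sup>-\<^sup>1 v\<close>, let \<open>r + 1\<close> be the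
  least \<open>k \<ge> 1\<close> with \<open>c\<^sub>k = 0\<close>. Then \<open>F\<^sup>r\<^sup>+\<^sup>1 v\<close> is again a highest weight vector, of a different
  weight, and vanishes by irreducibility; hence \<open>F\<^sup>r v\<close> is a highest weight vector for the reflected
  Borel subalgebra. For two adjacent entries of different parity, both coordinates change by one if a certain
  box belongs to the partition and both are zero otherwise.
\<close>

section \<open>Root vectors\<close>

text \<open>The vanishing of \<open>F^(r+1) v\<close> rests on uniqueness of the highest weight,
  which has to be extracted from irreducibility alone: an integral Cartan element grades the module
  downwards from any singular vector, and two singular vectors that generate the same module must
  sit in the same top degree. Singularity is measured against an integer function on the axes
  instead of a Borel subalgebra. Such a function may take equal values at two labels, and the
  reflection step depends on this: on the wall between neighbouring orderings E and F have degree
  zero, so every \<open>F^k v\<close> stays singular for the wall, and only the few root vectors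
  tied to E or F remain to be examined. The three kinds of simple roots are treated by one recursion
  for the coefficients, because all root vectors have the form \<open>rv c d\<close>, the
  superbracket enters only through one sign s, and a sign change of the last entry p is an exchange
  of p with the label \<open>Zero\<close>. The cases differ only in the solution of the recursion;
  that its first zero lies where the coordinates require is what the partition supplies.\<close>

fun bar :: "label \<Rightarrow> label" where
  "bar (Pos x) = Neg x"
| "bar (Neg x) = Pos x"
| "bar Zero = Zero"

fun lval :: "(axis \<Rightarrow> 'a::ab_group_add) \<Rightarrow> label \<Rightarrow> 'a" where
  "lval g (Pos x) = g x"
| "lval g (Neg x) = - g x"
| "lval g Zero = 0"

definition wt :: "label \<Rightarrow> weight" where
  "wt c = (\<lambda>x. if c = Pos x then 1 else if c = Neg x then -1 else 0)"

lemma bar_bar [simp]: "bar (bar a) = a"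
  by (cases a) auto

lemma bar_eq_iff [simp]: "bar a = bar b \<longleftrightarrow> a = b"
  by (metis bar_bar)

lemma bar_Zero_iff [simp]: "bar a = Zero \<longleftrightarrow> a = Zero" "Zero = bar a \<longleftrightarrow> a = Zero"
  by (cases a; auto)+

lemma bar_self_iff [simp]: "bar a = a \<longleftrightarrow> a = Zero" "a = bar a \<longleftrightarrow> a = Zero"
  by (cases a; auto)+

lemma parity_bar [simp]: "parity (bar a) = parity a"
  by (cases a rule: parity.cases) auto

lemma lval_bar [simp]: "lval g (bar a) = - lval g a"
  by (cases a) auto

lemma wt_bar [simp]: "wt (bar a) = - wt a"
  by (cases a) (auto simp: wt_def fun_eq_iff)

lemma finite_axes [simp]: "finite (axes n m)"
  by (simp add: axes_def)

lemma finite_labels [simp]: "finite (labels n m)"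
  by (simp add: labels_def)

lemma labels_simps [simp]:
  "Pos x \<in> labels n m \<longleftrightarrow> x \<in> axes n m" "Neg x \<in> labels n m \<longleftrightarrow> x \<in> axes n m"
  "Zero \<in> labels n m"
  by (auto simp: labels_def)

lemma bar_labels [simp]: "bar a \<in> labels n m \<longleftrightarrow> a \<in> labels n m"
  by (cases a) auto

lemma bar_image_labels: "bar ` labels n m = labels n m"
proof (intro equalityI subsetI)
  fix a assume "a \<in> labels n m"
  then show "a \<in> bar ` labels n m" by (intro image_eqI[of _ _ "bar a"]) auto
qed auto

lemma sum_labels_bar: "(\<Sum>e\<in>labels n m. g (bar e)) = (\<Sum>e\<in>labels n m. g e)"
proof -
  have "sum g (bar ` labels n m) = (\<Sum>e\<in>labels n m. g (bar e))"
    by (rule sum.reindex[unfolded o_def]) (auto simp: inj_on_def)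
  then show ?thesis by (simp add: bar_image_labels)
qed

section \<open>Invariance of the form as a symmetry of matrix entries\<close>

lemma parity_cases: "parity a = 0 \<or> parity a = 1"
  by (cases a rule: parity.cases) auto

text \<open>\<open>phi a\<close> is the only nonzero entry in row \<open>a\<close> of the form.\<close>

definition phi :: "label \<Rightarrow> complex" where
  "phi a = form a (bar a)"

lemma form_eq: "form a b = (if b = bar a then phi a else 0)"
  by (cases a rule: parity.cases) (auto simp: phi_def)

lemma phi_cases: "phi a = 1 \<or> phi a = -1"
  by (cases a rule: parity.cases) (auto simp: phi_def)

lemma phi_sq [simp]: "phi a * phi a = 1" "phi a * (phi a * z) = z"
  using phi_cases[of a] by auto

lemma phi_bar: "phi (bar a) = - ((-1) ^ parity a) * phi a"
  by (cases a rule: parity.cases) (auto simp: phi_def)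

text \<open>The sign by which invariance of the form ties the entry at (c, d) to the one at (bar d,
  bar c). The parity of the matrix does not occur, so one rule serves even and odd elements.\<close>

definition sg :: "label \<Rightarrow> label \<Rightarrow> complex" where
  "sg c d = - ((-1) ^ (parity c * parity d + parity d)) * phi c * phi d"

lemma sg_cases: "sg c d = 1 \<or> sg c d = -1"
  using phi_cases[of c] phi_cases[of d] parity_cases[of c] parity_cases[of d]
  by (auto simp: sg_def)

lemma sg_sq [simp]: "sg c d * sg c d = 1"
  using sg_cases[of c d] by auto

lemma sg_bar: "sg (bar d) (bar c) = sg c d"
  using parity_cases[of c] parity_cases[of d]
  by (auto simp: sg_def phi_bar mult.commute)

lemma sg_self [simp]: "sg c c = -1"
  using parity_cases[of c] by (auto simp: sg_def)

lemma sg_bar_right: "sg c (bar c) = (-1) ^ parity c"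
  using parity_cases[of c] by (auto simp: sg_def phi_bar)

lemma sg_swap: "sg c d * sg d c = (-1) ^ (parity c + parity d)"
  using parity_cases[of c] parity_cases[of d] phi_cases[of c] phi_cases[of d]
  by (auto simp: sg_def)

text \<open>Every row of the form has a single nonzero entry, so both sums in the invariance
  condition collapse to one term. Multiplying by \<open>phi c\<close>, which is a sign, then
  isolates \<open>X c d\<close>.\<close>

lemma osp_part_iff:
  assumes "q \<in> {0, 1}"
  shows "X \<in> osp_part n m q \<longleftrightarrow> X \<in> gl_part n m q \<and>
     (\<forall>c\<in>labels n m. \<forall>d\<in>labels n m. X c d = sg c d * X (bar d) (bar c))"
proof (cases "X \<in> gl_part n m q")
  case True
  have sumL: "(\<Sum>c\<in>labels n m. X c a * form c b) = X (bar b) a * phi (bar b)"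
    if "b \<in> labels n m" for a b
  proof -
    have "(\<Sum>c\<in>labels n m. X c a * form c b) = (\<Sum>c\<in>{bar b}. X c a * form c b)"
      using that by (intro sum.mono_neutral_right) (auto simp: form_eq)
    then show ?thesis by (simp add: form_eq)
  qed
  have sumR: "(\<Sum>c\<in>labels n m. form a c * X c b) = phi a * X (bar a) b"
    if "a \<in> labels n m" for a b
  proof -
    have "(\<Sum>c\<in>labels n m. form a c * X c b) = (\<Sum>c\<in>{bar a}. form a c * X c b)"
      using that by (intro sum.mono_neutral_right) (auto simp: form_eq)
    then show ?thesis by (simp add: form_eq)
  qed
  have key: "X c d * phi c + (-1) ^ (q * parity d) * (phi d * X (bar d) (bar c)) = 0
      \<longleftrightarrow> X c d = sg c d * X (bar d) (bar c)" if "c \<in> labels n m" "d \<in> labels n m" for c d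
  proof (cases "X c d = 0 \<and> X (bar d) (bar c) = 0")
    case False
    then have "(parity c + parity d) mod 2 = q"
      using True unfolding gl_part_def mem_Collect_eq by (metis parity_bar add.commute)
    \<comment> \<open>Here q is parity c + parity d modulo 2, and the square of parity d is parity
      d; this removes q from the sign.\<close>
    then have e: "(-1::complex) ^ (q * parity d) = (-1) ^ (parity c * parity d + parity d)"
      using parity_cases[of c] parity_cases[of d] by auto
    have "X c d * phi c + (-1) ^ (q * parity d) * (phi d * X (bar d) (bar c)) = 0
      \<longleftrightarrow> phi c * (X c d * phi c + (-1) ^ (q * parity d) * (phi d * X (bar d) (bar c))) = 0"
      using phi_cases[of c] by auto
    also have "phi c * (X c d * phi c + (-1) ^ (q * parity d) * (phi d * X (bar d) (bar c)))
       = X c d - sg c d * X (bar d) (bar c)"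
      unfolding e using phi_cases[of c] by (auto simp: sg_def algebra_simps)
    finally show ?thesis by simp
  qed auto
  have "X \<in> osp_part n m q \<longleftrightarrow> (\<forall>a\<in>labels n m. \<forall>b\<in>labels n m.
     X (bar b) a * phi (bar b) + (-1) ^ (q * parity a) * (phi a * X (bar a) b) = 0)"
    using True by (simp add: osp_part_def sumL sumR)
  also have "\<dots> \<longleftrightarrow> (\<forall>a\<in>labels n m. \<forall>c\<in>labels n m.
     X c a * phi c + (-1) ^ (q * parity a) * (phi a * X (bar a) (bar c)) = 0)"
    by (metis bar_bar bar_labels)
  finally show ?thesis using True key by auto
next
  case False
  then show ?thesis by (simp add: osp_part_def)
qed

text \<open>The matrix unit at (c, d), completed by the entry that invariance forces at (bar d, bar
  c). For d = bar c the two positions coincide: the entries add up to 2 if c is even and cancel if c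
  is odd, just as twice a delta is a root and twice an epsilon is not. For c = d it is a diagonal
  element.\<close>

definition rv :: "label \<Rightarrow> label \<Rightarrow> mat" where
  "rv c d = (\<lambda>a b. (if a = c \<and> b = d then 1 else 0) +
                    (if a = bar d \<and> b = bar c then sg c d else 0))"

lemma rv_osp_part:
  assumes "c \<in> labels n m" "d \<in> labels n m"
  shows "rv c d \<in> osp_part n m ((parity c + parity d) mod 2)"
proof -
  have sw: "bar b = c \<and> bar a = d \<longleftrightarrow> a = bar d \<and> b = bar c" for a b
    by (metis bar_bar)
  have "rv c d a b = sg a b * rv c d (bar b) (bar a)" for a b
  proof -
    have 1: "rv c d (bar b) (bar a) = (if a = bar d \<and> b = bar c then 1 else 0) +
        (if a = c \<and> b = d then sg c d else 0)"
      unfolding rv_def sw bar_eq_iff by (simp only: conj_commute)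
    have 2: "sg a b * (if a = bar d \<and> b = bar c then 1 else 0) =
        (if a = bar d \<and> b = bar c then sg c d else 0)"
      by (simp add: sg_bar)
    have 3: "sg a b * (if a = c \<and> b = d then sg c d else 0) = (if a = c \<and> b = d then 1 else 0)"
      by simp
    show ?thesis unfolding 1 distrib_left 2 3 by (subst add.commute) (rule fun_cong[OF fun_cong[OF rv_def]])
  qed
  moreover have "rv c d \<in> gl_part n m ((parity c + parity d) mod 2)"
    unfolding gl_part_def mem_Collect_eq
  proof (intro allI impI)
    fix a b assume "rv c d a b \<noteq> 0"
    then have "a = c \<and> b = d \<or> a = bar d \<and> b = bar c" by (auto simp: rv_def split: if_splits)
    then show "a \<in> labels n m \<and> b \<in> labels n m \<and>
        (parity a + parity b) mod 2 = (parity c + parity d) mod 2"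
      using assms by (auto simp: add.commute)
  qed
  moreover have "(parity c + parity d) mod 2 \<in> {0, 1}" by auto
  ultimately show ?thesis by (subst osp_part_iff) blast+
qed

section \<open>Linear structure, spanning root vectors and closure under the bracket\<close>

lemma zero_osp_part: "q \<in> {0, 1} \<Longrightarrow> 0 \<in> osp_part n m q"
  by (subst osp_part_iff) (auto simp: gl_part_def)

lemma osp_part_osp: "X \<in> osp_part n m q \<Longrightarrow> q \<in> {0, 1} \<Longrightarrow> X \<in> osp n m"
  unfolding osp_def using zero_osp_part[of 0] zero_osp_part[of 1]
  by (auto intro: exI[of _ X] exI[of _ 0])

lemma rv_osp: "c \<in> labels n m \<Longrightarrow> d \<in> labels n m \<Longrightarrow> rv c d \<in> osp n m"
  by (rule osp_part_osp[OF rv_osp_part]) auto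

lemma osp_support:
  assumes "X \<in> osp n m" "X c d \<noteq> 0"
  shows "c \<in> labels n m \<and> d \<in> labels n m"
proof -
  obtain Y Z where "X = Y + Z" "Y \<in> osp_part n m 0" "Z \<in> osp_part n m 1"
    using assms(1) by (auto simp: osp_def)
  then have "Y c d \<noteq> 0 \<or> Z c d \<noteq> 0" "Y \<in> gl_part n m 0" "Z \<in> gl_part n m 1"
    using assms(2) by (auto simp: osp_part_def)
  then show ?thesis unfolding gl_part_def by blast
qed

lemma osp_symmetric:
  assumes X: "X \<in> osp n m"
  shows "X c d = sg c d * X (bar d) (bar c)"
proof (cases "c \<in> labels n m \<and> d \<in> labels n m")
  case True
  obtain Y Z where "X = Y + Z" "Y \<in> osp_part n m 0" "Z \<in> osp_part n m 1"
    using X by (auto simp: osp_def)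
  moreover have "Y c d = sg c d * Y (bar d) (bar c)" "Z c d = sg c d * Z (bar d) (bar c)"
    using calculation True osp_part_iff by blast+
  ultimately show ?thesis by (simp add: distrib_left)
next
  case False
  then have "X c d = 0" "X (bar d) (bar c) = 0"
    using osp_support[OF X, of c d] osp_support[OF X, of "bar d" "bar c"] unfolding bar_labels by blast+
  then show ?thesis by simp
qed

lemma mat_scale_osp_part:
  assumes "q \<in> {0, 1}" "X \<in> osp_part n m q"
  shows "mat_scale k X \<in> osp_part n m q"
proof -
  have "mat_scale k X \<in> gl_part n m q"
    using assms(2) unfolding osp_part_def gl_part_def mat_scale_def by auto
  moreover have "mat_scale k X c d = sg c d * mat_scale k X (bar d) (bar c)"
    if "c \<in> labels n m" "d \<in> labels n m" for c d
  proof -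
    have "X c d = sg c d * X (bar d) (bar c)"
      using assms that osp_part_iff by blast
    then show ?thesis unfolding mat_scale_def by (metis mult.left_commute)
  qed
  ultimately show ?thesis using assms(1) osp_part_iff by blast
qed

lemma add_osp_part:
  assumes "q \<in> {0, 1}" "X \<in> osp_part n m q" "Y \<in> osp_part n m q"
  shows "X + Y \<in> osp_part n m q"
proof -
  have "X a b \<noteq> 0 \<or> Y a b \<noteq> 0" if "(X + Y) a b \<noteq> 0" for a b
    using that by auto
  moreover have "X \<in> gl_part n m q" "Y \<in> gl_part n m q"
    using assms by (auto simp: osp_part_def)
  ultimately have gl: "X + Y \<in> gl_part n m q" unfolding gl_part_def mem_Collect_eq by blast
  have "(X + Y) c d = sg c d * (X + Y) (bar d) (bar c)" if "c \<in> labels n m" "d \<in> labels n m" for c d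
  proof -
    have "X c d = sg c d * X (bar d) (bar c)" "Y c d = sg c d * Y (bar d) (bar c)"
      using assms that osp_part_iff by blast+
    then show ?thesis by (simp add: distrib_left)
  qed
  with gl show ?thesis using assms(1) osp_part_iff by blast
qed

lemma mat_scale_add: "mat_scale k (X + Y) = mat_scale k X + mat_scale k Y"
  by (auto simp: mat_scale_def fun_eq_iff distrib_left)

lemma add_osp:
  assumes "X \<in> osp n m" "Y \<in> osp n m" shows "X + Y \<in> osp n m"
proof -
  obtain X0 X1 Y0 Y1 where "X = X0 + X1" "X0 \<in> osp_part n m 0" "X1 \<in> osp_part n m 1"
     "Y = Y0 + Y1" "Y0 \<in> osp_part n m 0" "Y1 \<in> osp_part n m 1"
    using assms by (auto simp: osp_def)
  moreover have "X0 + Y0 \<in> osp_part n m 0" "X1 + Y1 \<in> osp_part n m 1"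
    using calculation by (auto intro: add_osp_part)
  moreover have "X + Y = (X0 + Y0) + (X1 + Y1)"
    using calculation(1,4) by (simp only: add_ac)
  ultimately show ?thesis unfolding osp_def by blast
qed

lemma mat_scale_osp:
  assumes "X \<in> osp n m"
  shows "mat_scale k X \<in> osp n m"
proof -
  obtain X0 X1 where "X = X0 + X1" "X0 \<in> osp_part n m 0" "X1 \<in> osp_part n m 1"
    using assms by (auto simp: osp_def)
  moreover have "mat_scale k X0 \<in> osp_part n m 0" "mat_scale k X1 \<in> osp_part n m 1"
    using calculation by (auto intro: mat_scale_osp_part)
  ultimately show ?thesis unfolding osp_def using mat_scale_add by blast
qed

lemma zero_osp [simp]: "0 \<in> osp n m"
  using osp_part_osp zero_osp_part by blast

lemma sum_osp: "(\<And>i. i \<in> I \<Longrightarrow> X i \<in> osp n m) \<Longrightarrow> (\<Sum>i\<in>I. X i) \<in> osp n m"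
  by (induction I rule: infinite_finite_induct) (auto intro: add_osp)

text \<open>The factor 1/2 is due to \<open>rv c d\<close> and \<open>rv (bar d) (bar c)\<close> being proportional.\<close>

lemma osp_expansion:
  assumes "X \<in> osp n m"
  shows "X = (\<Sum>cd\<in>labels n m \<times> labels n m.
     mat_scale (X (fst cd) (snd cd) / 2) (rv (fst cd) (snd cd)))"
proof (intro ext)
  fix a b :: label
  let ?L = "labels n m \<times> labels n m"
  have app: "(\<Sum>i\<in>I. Y i) a b = (\<Sum>i\<in>I. Y i a b)" for I :: "(label \<times> label) set" and Y
    by (induction I rule: infinite_finite_induct) auto
  have s1: "(\<Sum>cd\<in>?L. X (fst cd) (snd cd) / 2 * (if a = fst cd \<and> b = snd cd then 1 else 0))
     = X a b / 2"
  proof -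
    have "(\<Sum>cd\<in>?L. X (fst cd) (snd cd) / 2 * (if a = fst cd \<and> b = snd cd then 1 else 0))
       = (\<Sum>cd\<in>?L. if cd = (a, b) then X a b / 2 else 0)"
      by (rule sum.cong) auto
    also have "\<dots> = X a b / 2"
      using osp_support[OF assms, of a b] by (auto simp: sum.delta)
    finally show ?thesis .
  qed
  have s2: "(\<Sum>cd\<in>?L. X (fst cd) (snd cd) / 2 *
       (if a = bar (snd cd) \<and> b = bar (fst cd) then sg (fst cd) (snd cd) else 0)) = X a b / 2"
  proof -
    have "(\<Sum>cd\<in>?L. X (fst cd) (snd cd) / 2 *
        (if a = bar (snd cd) \<and> b = bar (fst cd) then sg (fst cd) (snd cd) else 0))
       = (\<Sum>cd\<in>?L. if cd = (bar b, bar a) then X (bar b) (bar a) / 2 * sg (bar b) (bar a) else 0)"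
      by (rule sum.cong) auto
    also have "\<dots> = X (bar b) (bar a) / 2 * sg (bar b) (bar a)"
      using osp_support[OF assms, of "bar b" "bar a"] by (auto simp: sum.delta)
    also have "\<dots> = X a b / 2"
      using osp_symmetric[OF assms, of a b] by (simp add: sg_bar mult.commute)
    finally show ?thesis .
  qed
  have "(\<Sum>cd\<in>?L. mat_scale (X (fst cd) (snd cd) / 2) (rv (fst cd) (snd cd))) a b
    = (\<Sum>cd\<in>?L. X (fst cd) (snd cd) / 2 * (if a = fst cd \<and> b = snd cd then 1 else 0)) +
      (\<Sum>cd\<in>?L. X (fst cd) (snd cd) / 2 *
         (if a = bar (snd cd) \<and> b = bar (fst cd) then sg (fst cd) (snd cd) else 0))"
    unfolding app mat_scale_def rv_def distrib_left sum.distrib ..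
  then show "X a b = (\<Sum>cd\<in>?L. mat_scale (X (fst cd) (snd cd) / 2) (rv (fst cd) (snd cd))) a b"
    unfolding s1 s2 by simp
qed

text \<open>Passing to the entry at (bar d, bar c) reverses products up to the sign in
  \<open>flip\<close>. It therefore interchanges the two terms of the superbracket, and the factor
  (-1)^(p q) between them is exactly what makes the result satisfy the symmetry again.\<close>

lemma superbracket_osp_part:
  assumes p: "p \<in> {0, 1}" and q: "q \<in> {0, 1}"
    and X: "X \<in> osp_part n m p" and Y: "Y \<in> osp_part n m q"
  shows "superbracket n m p q X Y \<in> osp_part n m ((p + q) mod 2)"
proof -
  have par: "(parity a + parity b) mod 2 = (r + r') mod 2 \<and> a \<in> labels n m \<and> b \<in> labels n m"
    if X: "X \<in> gl_part n m r" and Y: "Y \<in> gl_part n m r'" and "mat_mult n m X Y a b \<noteq> 0"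
    for X Y r r' a b
  proof -
    obtain e where "X a e * Y e b \<noteq> 0"
      using \<open>mat_mult n m X Y a b \<noteq> 0\<close> unfolding mat_mult_def by (meson sum.neutral)
    then have "X a e \<noteq> 0" "Y e b \<noteq> 0" by auto
    then have "(parity a + parity e) mod 2 = r" "(parity e + parity b) mod 2 = r'"
      "a \<in> labels n m" "b \<in> labels n m"
      using X Y by (auto simp: gl_part_def)
    then show ?thesis using parity_cases[of a] parity_cases[of b] parity_cases[of e] by auto
  qed
  have gX: "X \<in> gl_part n m p" and gY: "Y \<in> gl_part n m q"
    using X Y by (auto simp: osp_part_def)
  have gl: "superbracket n m p q X Y \<in> gl_part n m ((p + q) mod 2)"
    using par[OF gX gY] par[OF gY gX]
    unfolding gl_part_def superbracket_def mat_scale_def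
    by (auto simp: add.commute) (metis diff_0 minus_zero mult_zero_right)+
  have flip: "mat_mult n m X Y c d = - sg c d * (-1) ^ (r * r') * mat_mult n m Y X (bar d) (bar c)"
    if X: "X \<in> osp_part n m r" and Y: "Y \<in> osp_part n m r'" and r: "r \<in> {0, 1}" "r' \<in> {0, 1}"
      and "c \<in> labels n m" "d \<in> labels n m" for X Y r r' c d
  proof -
    have "X c e * Y e d = - sg c d * (-1) ^ (r * r') * (Y (bar d) (bar e) * X (bar e) (bar c))"
      if "e \<in> labels n m" for e
    proof (cases "X c e = 0 \<or> Y e d = 0")
      case True
      have "X c e = sg c e * X (bar e) (bar c)" "Y e d = sg e d * Y (bar d) (bar e)"
        using X Y r \<open>c \<in> _\<close> \<open>d \<in> _\<close> \<open>e \<in> _\<close> osp_part_iff by blast+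
      with True have "X (bar e) (bar c) = 0 \<or> Y (bar d) (bar e) = 0"
        using sg_cases[of c e] sg_cases[of e d] by fastforce
      with True show ?thesis by auto
    next
      case False
      then have pr: "(parity c + parity e) mod 2 = r" "(parity e + parity d) mod 2 = r'"
        using X Y by (auto simp: osp_part_def gl_part_def)
      \<comment> \<open>The factor \<open>phi e\<close> occurs twice and cancels; the rest is a
        parity count with r = parity c + parity e and r' = parity e + parity d modulo 2.\<close>
      have "sg c e * sg e d = - sg c d * (-1) ^ (r * r')"
        using parity_cases[of c] parity_cases[of d] parity_cases[of e] pr[symmetric]
        by (auto simp: sg_def)
      moreover have "X c e = sg c e * X (bar e) (bar c)" "Y e d = sg e d * Y (bar d) (bar e)"
        using X Y r \<open>c \<in> _\<close> \<open>d \<in> _\<close> \<open>e \<in> _\<close> osp_part_iff by blast+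
      ultimately show ?thesis by (metis mult.assoc mult.commute)
    qed
    then have "mat_mult n m X Y c d = (\<Sum>e\<in>labels n m.
       - sg c d * (-1) ^ (r * r') * (Y (bar d) (bar e) * X (bar e) (bar c)))"
      unfolding mat_mult_def by (intro sum.cong) auto
    also have "\<dots> = - sg c d * (-1) ^ (r * r') * mat_mult n m Y X (bar d) (bar c)"
      unfolding mat_mult_def sum_distrib_left[symmetric]
      by (subst sum_labels_bar[where g = "\<lambda>e. Y (bar d) e * X e (bar c)"]) simp
    finally show ?thesis .
  qed
  have "superbracket n m p q X Y c d = sg c d * superbracket n m p q X Y (bar d) (bar c)"
    if "c \<in> labels n m" "d \<in> labels n m" for c d
  proof -
    have "(-1::complex) ^ (p * q) = 1 \<or> (-1::complex) ^ (p * q) = -1"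
      using p q by auto
    then show ?thesis
      unfolding superbracket_def mat_scale_def
      using flip[OF X Y p q that] flip[OF Y X q p that]
      by (auto simp: mult.commute[of q p] algebra_simps)
  qed
  moreover have "(p + q) mod 2 \<in> {0, 1}" by auto
  ultimately show ?thesis using gl by (subst osp_part_iff) blast+
qed

lemma superbracket_osp:
  "p \<in> {0, 1} \<Longrightarrow> q \<in> {0, 1} \<Longrightarrow> X \<in> osp_part n m p \<Longrightarrow> Y \<in> osp_part n m q \<Longrightarrow>
   superbracket n m p q X Y \<in> osp n m"
  by (rule osp_part_osp[OF superbracket_osp_part]) auto

lemma rv_bar: "rv (bar d) (bar c) = mat_scale (sg c d) (rv c d)"
proof (intro ext)
  fix a b
  have "sg c d * (if a = bar d \<and> b = bar c then sg c d else 0) = (if a = bar d \<and> b = bar c then 1 else 0)"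
    by simp
  then show "rv (bar d) (bar c) a b = mat_scale (sg c d) (rv c d) a b"
    unfolding rv_def mat_scale_def bar_bar sg_bar distrib_left by simp
qed

section \<open>The Cartan subalgebra, weights and coroots\<close>

lemma cartan_osp_part: "H \<in> cartan n m \<Longrightarrow> H \<in> osp_part n m 0"
proof -
  assume H: "H \<in> cartan n m"
  then have "\<forall>a b. H a b \<noteq> 0 \<longrightarrow> a = b" "H \<in> osp n m" by (auto simp: cartan_def)
  moreover have "H \<in> gl_part n m 0"
    unfolding gl_part_def mem_Collect_eq
  proof (intro allI impI)
    fix a b assume "H a b \<noteq> 0"
    then have "a = b" "a \<in> labels n m" using H osp_support[of H n m a b] by (auto simp: cartan_def)
    then show "a \<in> labels n m \<and> b \<in> labels n m \<and> (parity a + parity b) mod 2 = 0" by simp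
  qed
  ultimately show ?thesis using osp_symmetric[of H n m] by (subst osp_part_iff) blast+
qed

lemma cartan_bar: "H \<in> cartan n m \<Longrightarrow> H (bar c) (bar c) = - H c c"
  using osp_symmetric[of H n m c c] by (auto simp: cartan_def)

lemma weight_eval_wt:
  assumes "H \<in> cartan n m" "c \<in> labels n m"
  shows "weight_eval n m (wt c) H = H c c"
proof -
  have *: "(\<Sum>x\<in>axes n m. (if z = x then k else 0) * H (Pos x) (Pos x)) = k * H (Pos z) (Pos z)"
    if "z \<in> axes n m" for z k
    using that by (subst sum.cong[OF refl, of _ _ "\<lambda>x. if z = x then k * H (Pos z) (Pos z) else 0"])
       (auto simp: sum.delta)
  show ?thesis
  proof (cases c)
    case (Pos x)
    then show ?thesis using assms *[of x 1] by (simp add: weight_eval_def wt_def cong: if_cong)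
  next
    case (Neg x)
    then show ?thesis using assms *[of x "-1"] cartan_bar[OF assms(1), of "Pos x"]
      by (simp add: weight_eval_def wt_def)
  next
    case Zero
    then show ?thesis using cartan_bar[OF assms(1), of Zero] by (simp add: weight_eval_def wt_def)
  qed
qed

lemma weight_eval_add: "weight_eval n m (\<mu> + \<nu>) H = weight_eval n m \<mu> H + weight_eval n m \<nu> H"
  by (simp add: weight_eval_def distrib_right sum.distrib)

lemma weight_eval_diff: "weight_eval n m (\<mu> - \<nu>) H = weight_eval n m \<mu> H - weight_eval n m \<nu> H"
  by (simp add: weight_eval_def left_diff_distrib sum_subtractf)

lemma bracket_cartan:
  assumes H: "H \<in> cartan n m" and X: "X \<in> osp n m"
  shows "superbracket n m 0 q H X a b = (H a a - H b b) * X a b"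
    "mat_mult n m H X a b - mat_mult n m X H a b = (H a a - H b b) * X a b"
proof -
  have d: "\<And>a b. a \<noteq> b \<Longrightarrow> H a b = 0" using H by (auto simp: cartan_def)
  have 1: "mat_mult n m H X a b = H a a * X a b"
  proof (cases "a \<in> labels n m")
    case True
    have "mat_mult n m H X a b = (\<Sum>c\<in>{a}. H a c * X c b)"
      unfolding mat_mult_def using True d[of a] by (intro sum.mono_neutral_right) auto
    then show ?thesis by simp
  next
    case False
    then have "H a c = 0" for c using H osp_support[of H n m a c] by (auto simp: cartan_def)
    then show ?thesis by (simp add: mat_mult_def)
  qed
  have 2: "mat_mult n m X H a b = X a b * H b b"
  proof (cases "b \<in> labels n m")
    case True
    have "mat_mult n m X H a b = (\<Sum>c\<in>{b}. X a c * H c b)"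
      unfolding mat_mult_def using True d[of _ b] by (intro sum.mono_neutral_right) auto
    then show ?thesis by simp
  next
    case False
    then have "H c b = 0" for c using H osp_support[of H n m c b] by (auto simp: cartan_def)
    then show ?thesis by (simp add: mat_mult_def)
  qed
  show "mat_mult n m H X a b - mat_mult n m X H a b = (H a a - H b b) * X a b"
    by (simp add: 1 2 algebra_simps)
  then show "superbracket n m 0 q H X a b = (H a a - H b b) * X a b"
    by (simp add: superbracket_def mat_scale_def)
qed

lemma bracket_cartan_rv:
  assumes "H \<in> cartan n m" "c \<in> labels n m" "d \<in> labels n m"
  shows "superbracket n m 0 q H (rv c d) = mat_scale (H c c - H d d) (rv c d)"
proof (intro ext)
  fix a b
  have 1: "(H a a - H b b) * (if a = c \<and> b = d then 1 else 0)
      = (H c c - H d d) * (if a = c \<and> b = d then 1 else 0)"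
    by simp
  have 2: "(H a a - H b b) * (if a = bar d \<and> b = bar c then sg c d else 0)
      = (H c c - H d d) * (if a = bar d \<and> b = bar c then sg c d else 0)"
    by (simp add: cartan_bar[OF assms(1)])
  show "superbracket n m 0 q H (rv c d) a b = mat_scale (H c c - H d d) (rv c d) a b"
    unfolding bracket_cartan(1)[OF assms(1) rv_osp[OF assms(2,3)]] mat_scale_def
    unfolding rv_def distrib_left 1 2 ..
qed

lemma mat_mult_rv:
  assumes "c \<in> labels n m" "d \<in> labels n m"
  shows "mat_mult n m (rv c d) Y a b =
    (if a = c then Y d b else 0) + (if a = bar d then sg c d * Y (bar c) b else 0)"
proof -
  have "mat_mult n m (rv c d) Y a b =
     (\<Sum>e\<in>labels n m. if d = e then (if a = c then Y d b else 0) else 0) +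
     (\<Sum>e\<in>labels n m. if bar c = e then (if a = bar d then sg c d * Y (bar c) b else 0) else 0)"
    unfolding mat_mult_def sum.distrib[symmetric]
  proof (rule sum.cong[OF refl])
    fix e
    have "(if a = c \<and> e = d then 1 else 0) * Y e b = (if d = e then (if a = c then Y d b else 0) else 0)"
      by simp
    moreover have "(if a = bar d \<and> e = bar c then sg c d else 0) * Y e b
      = (if bar c = e then (if a = bar d then sg c d * Y (bar c) b else 0) else 0)"
      by simp
    ultimately show "rv c d a e * Y e b = (if d = e then (if a = c then Y d b else 0) else 0) +
       (if bar c = e then (if a = bar d then sg c d * Y (bar c) b else 0) else 0)"
      unfolding rv_def distrib_right by simp
  qed
  then show ?thesis using assms by (simp add: sum.delta)
qed

lemma mat_mult_rv_opposite:
  assumes "p \<in> labels n m" "b \<in> labels n m" "p \<noteq> bar b"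
  shows "mat_mult n m (rv p b) (rv b p) x y = (if x = p \<and> y = p then 1 else 0) +
    (-1) ^ (parity p + parity b) * (if x = bar b \<and> y = bar b then 1 else 0)"
proof -
  have "b \<noteq> bar p" "bar p \<noteq> b"
    using assms(3) by auto
  then have "rv b p b y = (if y = p then 1 else 0)" "rv b p (bar p) y = (if y = bar b then sg b p else 0)"
    by (auto simp: rv_def)
  then show ?thesis
    unfolding mat_mult_rv[OF assms(1,2)] sg_swap[of p b, symmetric] by auto
qed

text \<open>The coroot of wt p - wt b, up to normalisation. Excluding p = bar b keeps the two
  entries of each root vector apart, so no cross terms arise. For b = Zero the second summand
  vanishes, since \<open>rv Zero Zero\<close> is 0.\<close>

lemma bracket_opposite:
  assumes "p \<in> labels n m" "b \<in> labels n m" "p \<noteq> bar b"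
    and q: "q = (parity p + parity b) mod 2"
  shows "superbracket n m q q (rv p b) (rv b p) = rv p p - mat_scale ((-1) ^ q) (rv b b)"
proof (intro ext)
  fix x y
  have e: "(-1::complex) ^ (parity p + parity b) = (-1) ^ q" "(-1::complex) ^ (q * q) = (-1) ^ q"
    "(-1::complex) ^ (parity b + parity p) = (-1) ^ q"
    using parity_cases[of p] parity_cases[of b] q by auto
  have e': "(-1::complex) ^ q = 1 \<or> (-1::complex) ^ q = -1"
    using parity_cases[of p] parity_cases[of b] q by auto
  have "b \<noteq> bar p" using assms(3) by auto
  have d: "rv c c x y = (if x = c \<and> y = c then 1 else 0) - (if x = bar c \<and> y = bar c then 1 else 0)" for c
    by (simp add: rv_def)
  show "superbracket n m q q (rv p b) (rv b p) x y = (rv p p - mat_scale ((-1) ^ q) (rv b b)) x y"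
    unfolding superbracket_def mat_scale_def fun_diff_def e d
      mat_mult_rv_opposite[OF assms(1-3)] mat_mult_rv_opposite[OF assms(2,1) \<open>b \<noteq> bar p\<close>]
    using e' by (elim disjE) (simp_all only: algebra_simps mult_1_left mult_minus_left minus_minus)
qed

lemma rv_diag_cartan: "c \<in> labels n m \<Longrightarrow> rv c c \<in> cartan n m"
  using rv_osp[of c n m c] by (auto simp: cartan_def rv_def)

lemma weight_eval_rv_diag:
  assumes "c \<in> labels n m"
  shows "weight_eval n m \<mu> (rv c c) = lval \<mu> c"
proof (cases c)
  case (Pos x)
  have "weight_eval n m \<mu> (rv c c) = (\<Sum>y\<in>axes n m. if x = y then \<mu> x else 0)"
    unfolding weight_eval_def by (rule sum.cong) (auto simp: rv_def Pos)
  then show ?thesis using assms by (simp add: Pos)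
next
  case (Neg x)
  have "weight_eval n m \<mu> (rv c c) = (\<Sum>y\<in>axes n m. if x = y then - \<mu> x else 0)"
    unfolding weight_eval_def by (rule sum.cong) (auto simp: rv_def Neg)
  then show ?thesis using assms by (simp add: Neg)
next
  case Zero
  then show ?thesis by (simp add: weight_eval_def rv_def)
qed

text \<open>The root vector for twice a delta is a multiple of the bracket of the odd short root
  vector with itself. A vector killed by the short root vector is thus killed by the long one, which
  matters when the last entry changes its sign.\<close>

lemma rv_long:
  assumes "p \<in> labels n m" "p \<noteq> Zero"
  shows "rv p (bar p) = 0 \<or>
    (parity p = 0 \<and> rv p (bar p) = mat_scale (sg p Zero) (superbracket n m 1 1 (rv p Zero) (rv p Zero)))"
proof (cases "parity p = 0")
  case True
  have "rv p (bar p) x y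
     = mat_scale (sg p Zero) (superbracket n m 1 1 (rv p Zero) (rv p Zero)) x y" for x y
    unfolding superbracket_def mat_scale_def fun_diff_def mat_mult_rv[OF assms(1) labels_simps(3)]
    using assms(2) True by (auto simp: rv_def sg_bar_right)
  then show ?thesis using True by blast
next
  case False
  then have "rv p (bar p) = 0"
    using parity_cases[of p] by (auto simp: rv_def fun_eq_iff sg_bar_right)
  then show ?thesis ..
qed

section \<open>Singular vectors\<close>

lemma rv_difference:
  "rv c d i j \<noteq> 0 \<Longrightarrow> lval y i - lval y j = lval y c - (lval y d :: int)"
  by (auto simp: rv_def split: if_splits)

text \<open>Giving the position (i, j) the degree \<open>lval y i - lval y j\<close> makes degrees
  add under matrix products. This is the integral grading of the superalgebra defined by y.\<close>

lemma superbracket_difference: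
  fixes y :: "axis \<Rightarrow> int"
  assumes X: "\<And>i j. X i j \<noteq> 0 \<Longrightarrow> lval y i - lval y j = s"
    and Y: "\<And>i j. Y i j \<noteq> 0 \<Longrightarrow> lval y i - lval y j = t"
    and "superbracket n m p q X Y i j \<noteq> 0"
  shows "lval y i - lval y j = s + t"
proof -
  have "mat_mult n m X Y i j \<noteq> 0 \<or> mat_mult n m Y X i j \<noteq> 0"
    using assms(3) by (auto simp: superbracket_def mat_scale_def)
  then obtain e where "X i e * Y e j \<noteq> 0 \<or> Y i e * X e j \<noteq> 0"
    unfolding mat_mult_def by (meson sum.neutral)
  then have "X i e \<noteq> 0 \<and> Y e j \<noteq> 0 \<or> Y i e \<noteq> 0 \<and> X e j \<noteq> 0" by auto
  then show ?thesis using X[of i e] Y[of e j] Y[of i e] X[of e j] by auto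
qed

section \<open>Singular vectors for integer functions on the axes\<close>

context osp_module
begin

definition homogeneous :: "'v \<Rightarrow> bool" where
  "homogeneous v \<longleftrightarrow> v \<in> V 0 \<or> v \<in> V 1"

definition weight_vector :: "weight \<Rightarrow> 'v \<Rightarrow> bool" where
  "weight_vector \<mu> v \<longleftrightarrow> (\<forall>H\<in>cartan n m. act H v = scale (weight_eval n m \<mu> H) v)"

text \<open>The function y stands for a Borel subalgebra when its values separate the labels. Ties
  impose no condition on the root vectors in either direction, so y may also lie on a wall between
  two Borel subalgebras.\<close>

definition singular :: "(axis \<Rightarrow> int) \<Rightarrow> 'v \<Rightarrow> bool" where
  "singular y v \<longleftrightarrow>
     (\<forall>c\<in>labels n m. \<forall>d\<in>labels n m. lval y d < lval y c \<longrightarrow> act (rv c d) v = 0)"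

lemma act_hom: "X \<in> osp n m \<Longrightarrow> module_hom scale scale (act X)"
  using act_linear by (auto simp: Vector_Spaces.linear_def)

lemmas act_vadd = module_hom.add[OF act_hom]
  and act_vscale = module_hom.scale[OF act_hom]
  and act_vzero = module_hom.zero[OF act_hom]
  and act_vdiff = module_hom.diff[OF act_hom]

lemma act_zero [simp]: "act 0 v = 0"
  using act_add[of 0 0 v] by simp

lemma act_sum: "(\<And>i. i \<in> I \<Longrightarrow> X i \<in> osp n m) \<Longrightarrow> act (\<Sum>i\<in>I. X i) v = (\<Sum>i\<in>I. act (X i) v)"
  by (induction I rule: infinite_finite_induct) (auto simp: act_add sum_osp)

text \<open>Follows from \<open>osp_expansion\<close>. Only root vectors in the support of X have to
  be tested, so information on the degree of X can be used.\<close>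

lemma act_mem:
  assumes X: "X \<in> osp n m" and W: "subspace W"
    and *: "\<And>c d. c \<in> labels n m \<Longrightarrow> d \<in> labels n m \<Longrightarrow> X c d \<noteq> 0 \<Longrightarrow> act (rv c d) v \<in> W"
  shows "act X v \<in> W"
proof -
  have "act X v = act (\<Sum>cd\<in>labels n m \<times> labels n m.
     mat_scale (X (fst cd) (snd cd) / 2) (rv (fst cd) (snd cd))) v"
    using osp_expansion[OF X] by simp
  also have "\<dots> = (\<Sum>cd\<in>labels n m \<times> labels n m.
      scale (X (fst cd) (snd cd) / 2) (act (rv (fst cd) (snd cd)) v))"
    by (subst act_sum) (auto simp: mat_scale_osp rv_osp act_scale intro!: sum.cong)
  also have "\<dots> \<in> W"
  proof (rule subspace_sum[OF W])
    fix cd assume "cd \<in> labels n m \<times> labels n m"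
    then show "scale (X (fst cd) (snd cd) / 2) (act (rv (fst cd) (snd cd)) v) \<in> W"
      using *[of "fst cd" "snd cd"] W subspace_0[OF W]
      by (cases "X (fst cd) (snd cd) = 0") (auto intro: subspace_scale)
  qed
  finally show ?thesis .
qed

lemma act_commute:
  assumes "p \<in> {0, 1}" "q \<in> {0, 1}" "X \<in> osp_part n m p" "Y \<in> osp_part n m q"
  shows "act X (act Y v) = scale ((-1) ^ (p * q)) (act Y (act X v)) + act (superbracket n m p q X Y) v"
  using act_bracket[OF assms] by simp

lemma parity_01: "(parity c + parity d) mod 2 \<in> {0, 1}"
  by auto

lemma weight_vector_rv:
  assumes "weight_vector \<mu> v" and c: "c \<in> labels n m" and d: "d \<in> labels n m"
  shows "weight_vector (\<mu> + wt c - wt d) (act (rv c d) v)"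
  unfolding weight_vector_def
proof
  fix H assume H: "H \<in> cartan n m"
  have "act H (act (rv c d) v) = scale ((-1) ^ (0 * ((parity c + parity d) mod 2))) (act (rv c d) (act H v)) +
     act (superbracket n m 0 ((parity c + parity d) mod 2) H (rv c d)) v"
    using cartan_osp_part[OF H] rv_osp_part[OF c d] by (intro act_commute) auto
  also have "\<dots> = act (rv c d) (act H v) + scale (H c c - H d d) (act (rv c d) v)"
    by (simp add: bracket_cartan_rv H c d act_scale rv_osp)
  also have "act H v = scale (weight_eval n m \<mu> H) v"
    using assms(1) H by (simp add: weight_vector_def)
  finally show "act H (act (rv c d) v) = scale (weight_eval n m (\<mu> + wt c - wt d) H) (act (rv c d) v)"
    using act_vscale[OF rv_osp[OF c d]]
    by (simp add: weight_eval_diff weight_eval_add weight_eval_wt H c d algebra_simps)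
qed

lemma homogeneous_act:
  assumes "q \<in> {0, 1}" "X \<in> osp_part n m q" "homogeneous v"
  shows "homogeneous (act X v)"
proof -
  obtain r where r: "r \<in> {0, 1}" "v \<in> V r"
    using assms(3) by (auto simp: homogeneous_def)
  then have "act X v \<in> V ((q + r) mod 2)"
    using act_parity assms by blast
  moreover have "(q + r) mod 2 = 0 \<or> (q + r) mod 2 = 1" by auto
  ultimately show ?thesis by (auto simp: homogeneous_def)
qed

lemma homogeneous_rv:
  "c \<in> labels n m \<Longrightarrow> d \<in> labels n m \<Longrightarrow> homogeneous v \<Longrightarrow> homogeneous (act (rv c d) v)"
  using homogeneous_act[OF parity_01 rv_osp_part] by blast

lemma grading_components:
  assumes "q \<in> {0, 1}" "a \<in> V q" "b \<in> V ((q + 1) mod 2)" "a + b = 0"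
  shows "a = 0" "b = 0"
proof -
  have sub: "subspace (V q)"
    using assms(1) subspace_even subspace_odd by auto
  have "b = - a" using assms(4) by (metis neg_eq_iff_add_eq_0)
  then have "b \<in> V q" using subspace_neg[OF sub assms(2)] by simp
  moreover have "V q \<inter> V ((q + 1) mod 2) = {0}"
  proof (cases "q = 0")
    case False
    then have "q = 1" using assms(1) by simp
    moreover have "V 1 \<inter> V 0 = {0}" using grading_disjoint by (subst Int_commute)
    ultimately show ?thesis by simp
  qed (use grading_disjoint in simp)
  ultimately show "b = 0" using assms(3) by auto
  then show "a = 0" using assms(4) by simp
qed

text \<open>Root vectors and Cartan elements are homogeneous, so annihilation and the eigenvalue
  equations hold for the two graded components separately. \<open>highest_weight\<close> does not
  speak of parity, whereas a vector must be homogeneous for its descendants to span a graded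
  subspace.\<close>

lemma homogeneous_singular:
  assumes "v \<noteq> 0" "singular y v" "weight_vector \<mu> v"
  shows "\<exists>v'. v' \<noteq> 0 \<and> homogeneous v' \<and> singular y v' \<and> weight_vector \<mu> v'"
proof -
  obtain a b where ab: "a \<in> V 0" "b \<in> V 1" "v = a + b"
    using grading_total by blast
  have "act (rv c d) a = 0 \<and> act (rv c d) b = 0"
    if "c \<in> labels n m" "d \<in> labels n m" "lval y d < lval y c" for c d
  proof -
    define q where "q = (parity c + parity d) mod 2"
    have q: "q \<in> {0, 1}" by (auto simp: q_def)
    have X: "rv c d \<in> osp_part n m q" using rv_osp_part that by (simp add: q_def)
    have "act (rv c d) a \<in> V ((q + 0) mod 2)" "act (rv c d) b \<in> V ((q + 1) mod 2)"
      using act_parity[OF q _ X, of 0 a] act_parity[OF q _ X, of 1 b] ab by auto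
    moreover have "(q + 0) mod 2 = q" using q by auto
    moreover have "act (rv c d) a + act (rv c d) b = 0"
      using assms(2) that ab act_vadd[OF rv_osp] by (auto simp: singular_def)
    ultimately show ?thesis using grading_components[OF q] by auto
  qed
  then have s: "singular y a" "singular y b" by (auto simp: singular_def)
  have "act H a = scale (weight_eval n m \<mu> H) a \<and> act H b = scale (weight_eval n m \<mu> H) b"
    if H: "H \<in> cartan n m" for H
  proof -
    let ?z = "weight_eval n m \<mu> H"
    have "act H a \<in> V ((0 + 0) mod 2)" "act H b \<in> V ((0 + 1) mod 2)"
      by (rule act_parity[OF _ _ cartan_osp_part[OF H]]; use ab in simp)+
    then have "act H a - scale ?z a \<in> V 0" "act H b - scale ?z b \<in> V ((0 + 1) mod 2)"
      using ab subspace_even subspace_odd by (auto intro!: subspace_diff subspace_scale)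
    moreover have "act H a - scale ?z a + (act H b - scale ?z b) = 0"
    proof -
      have "act H (a + b) = scale ?z (a + b)"
        using assms(3) H ab by (simp add: weight_vector_def)
      moreover have "H \<in> osp n m" using H by (simp add: cartan_def)
      ultimately show ?thesis by (simp add: act_vadd scale_right_distrib algebra_simps)
    qed
    ultimately show ?thesis using grading_components[of 0] by fastforce
  qed
  then have w: "weight_vector \<mu> a" "weight_vector \<mu> b" by (auto simp: weight_vector_def)
  have "a \<noteq> 0 \<or> b \<noteq> 0" using ab assms(1) by auto
  then show ?thesis using s w ab by (auto simp: homogeneous_def)
qed

text \<open>For large \<open>N\<close>, the polynomial \<open>(f - e) (f - (e - 1)) \<dots> (f - (e - N + 1))\<close> in \<open>f\<close>
  annihilates \<open>x\<close>, while it acts on the eigenvector \<open>x\<close> by a scalar.\<close>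

lemma eigenvalue_of_span:
  assumes f: "module_hom scale scale f"
    and S: "\<And>u. u \<in> S \<Longrightarrow> \<exists>k::nat. f u = scale (e - of_nat k) u"
    and x: "x \<in> span S" "f x = scale z x" "x \<noteq> 0"
  shows "\<exists>k::nat. z = e - of_nat k"
proof -
  define K where "K = rec_nat (\<lambda>x. x) (\<lambda>N g x. f (g x) - scale (e - of_nat N) (g x))"
  have K0: "K 0 x = x" and KS: "K (Suc N) x = f (K N x) - scale (e - of_nat N) (K N x)" for N x
    by (simp_all add: K_def)
  note fl = module_hom.add[OF f] module_hom.scale[OF f] module_hom.zero[OF f]
  have Kadd: "K N (x + y) = K N x + K N y" for N x y
    by (induction N) (auto simp: K0 KS fl algebra_simps)
  have Kscale: "K N (scale c x) = scale c (K N x)" for N c x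
    by (induction N) (auto simp: K0 KS fl algebra_simps)
  have Keig: "K N x = scale (\<Prod>k<N. t - (e - of_nat k)) x" if "f x = scale t x" for N x t
    by (induction N) (auto simp: K0 KS fl that algebra_simps)
  have Kmono: "K N x = 0 \<Longrightarrow> K (N + j) x = 0" for N j x
    by (induction j) (auto simp: KS fl)
  have "\<exists>N. K N x = 0"
    using x(1)
  proof (induction rule: span_induct_alt)
    case base
    show ?case by (auto simp: K0 intro: exI[of _ 0])
  next
    case (step c u x)
    obtain k :: nat where k: "f u = scale (e - of_nat k) u" using S step by blast
    obtain N where N: "K N x = 0" using step by blast
    have "(\<Prod>j<Suc k. (e - of_nat k) - (e - of_nat j)) = 0"
      by (rule prod_zero[OF finite_lessThan], rule bexI[of _ k]) auto
    then have "K (Suc k) u = 0" by (simp add: Keig[OF k] del: prod.lessThan_Suc)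
    then have "K (Suc k + N) (scale c u + x) = 0"
      using Kmono[of "Suc k" u N] Kmono[OF N, of "Suc k"] by (simp add: Kadd Kscale add.commute)
    then show ?case by blast
  qed
  then obtain N where "K N x = 0" by blast
  then have "(\<Prod>k<N. z - (e - of_nat k)) = 0"
    using x by (simp add: Keig[OF x(2)])
  then obtain k where "z - (e - of_nat k) = 0" by (auto simp: prod_zero_iff)
  then show ?thesis by auto
qed

text \<open>Words in lowering root vectors applied to v. The number is the total drop of y, which is
  how far the eigenvalue of \<open>grading_element y\<close> has decreased; only v itself has number
  0.\<close>

inductive descendant :: "(axis \<Rightarrow> int) \<Rightarrow> 'v \<Rightarrow> nat \<Rightarrow> 'v \<Rightarrow> bool" for y :: "axis \<Rightarrow> int" and v :: 'v where
  self: "descendant y v 0 v"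
| lower: "descendant y v k u \<Longrightarrow> c \<in> labels n m \<Longrightarrow> d \<in> labels n m \<Longrightarrow> lval y c < lval y d \<Longrightarrow>
    descendant y v (k + nat (lval y d - lval y c)) (act (rv c d) u)"

lemma descendant_homogeneous: "descendant y v k u \<Longrightarrow> homogeneous v \<Longrightarrow> homogeneous u"
  by (induction rule: descendant.induct) (auto intro: homogeneous_rv)

lemma descendant_span: "descendant y v k u \<Longrightarrow> u \<in> span {u. \<exists>k. descendant y v k u}"
  by (rule span_base) blast

lemma descendant_zero: "descendant y v 0 u \<Longrightarrow> u = v"
  by (erule descendant.cases) auto

definition grading_element :: "(axis \<Rightarrow> int) \<Rightarrow> mat" where
  "grading_element y = (\<lambda>a b. if a = b \<and> a \<in> labels n m then of_int (lval y a) else 0)"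

lemma grading_element_cartan: "grading_element y \<in> cartan n m"
proof -
  let ?H = "grading_element y"
  have "?H \<in> gl_part n m 0"
    by (auto simp: gl_part_def grading_element_def)
  moreover have "?H c d = sg c d * ?H (bar d) (bar c)" for c d
    by (cases "c = d") (auto simp: grading_element_def)
  ultimately have "?H \<in> osp_part n m 0" by (subst osp_part_iff) blast+
  then show ?thesis unfolding cartan_def using osp_part_osp
    by (auto simp: grading_element_def)
qed

lemma descendant_eigenvector:
  assumes "descendant y v k u" "weight_vector \<mu> v"
  shows "act (grading_element y) u = scale (weight_eval n m \<mu> (grading_element y) - of_nat k) u"
proof -
  let ?H = "grading_element y"
  have "\<exists>\<nu>. weight_vector \<nu> u \<and> weight_eval n m \<nu> ?H = weight_eval n m \<mu> ?H - of_nat k"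
    using assms
  proof (induction rule: descendant.induct)
    case self
    then show ?case by auto
  next
    case (lower k u c d)
    then obtain \<nu> where \<nu>: "weight_vector \<nu> u" "weight_eval n m \<nu> ?H = weight_eval n m \<mu> ?H - of_nat k"
      by blast
    have "weight_eval n m (\<nu> + wt c - wt d) ?H =
        weight_eval n m \<mu> ?H - of_nat (k + nat (lval y d - lval y c))"
      using lower.hyps \<nu>(2) of_nat_nat[of "lval y d - lval y c", where ?'a = complex]
      by (simp add: weight_eval_add weight_eval_diff weight_eval_wt[OF grading_element_cartan])
        (simp add: grading_element_def)
    then show ?case using weight_vector_rv[OF \<nu>(1) lower.hyps(2,3)] by blast
  qed
  then show ?thesis using grading_element_cartan by (auto simp: weight_vector_def)
qed

text \<open>Moving X past the outermost lowering operator F leaves F X u and the bracket applied to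
  u, so the induction must run over all X at once. Injectivity of y on the labels ensures that every
  \<open>rv c d\<close> is raising, diagonal or lowering, which settles the word of length
  zero.\<close>

lemma act_descendant:
  assumes "descendant y v k u" and "weight_vector \<mu> v" "singular y v"
    and inj: "inj_on (lval y) (labels n m)" and "X \<in> osp n m"
  shows "act X u \<in> span {u. \<exists>k. descendant y v k u}"
  using assms(1,5)
proof (induction arbitrary: X rule: descendant.induct)
  case self
  show ?case
  proof (rule act_mem[OF \<open>X \<in> osp n m\<close> subspace_span])
    fix c d assume cd: "c \<in> labels n m" "d \<in> labels n m"
    consider "lval y d < lval y c" | "c = d" | "lval y c < lval y d"
      using inj cd by (metis inj_onD linorder_less_linear)
    then show "act (rv c d) v \<in> span {u. \<exists>k. descendant y v k u}"
    proof cases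
      case 1
      then show ?thesis using assms(3) cd by (simp add: singular_def span_zero)
    next
      case 2
      then have "act (rv c d) v = scale (weight_eval n m \<mu> (rv c d)) v"
        using assms(2) cd rv_diag_cartan by (auto simp: weight_vector_def)
      then show ?thesis using span_scale[OF descendant_span[OF descendant.self]] by simp
    next
      case 3
      then show ?thesis by (rule descendant_span[OF descendant.lower[OF descendant.self cd]])
    qed
  qed
next
  case (lower k u c d)
  let ?W = "span {u. \<exists>k. descendant y v k u}"
  \<comment> \<open>Stability of the whole span under the lowering operator, needed for the term in
    which X has already been moved inside.\<close>
  have *: "act (rv c d) w \<in> ?W" if "w \<in> ?W" for w
    using that
  proof (induction rule: span_induct_alt)
    case base
    then show ?case using act_vzero rv_osp lower.hyps by (simp add: span_zero)
  next
    case (step a x w)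
    then obtain k where "descendant y v k x" by blast
    then have "act (rv c d) x \<in> ?W"
      using descendant_span[OF descendant.lower[OF _ lower.hyps(2-4)]] by blast
    then show ?case
      using step.IH rv_osp[OF lower.hyps(2,3)] by (simp add: act_vadd act_vscale span_add span_scale)
  qed
  have "act X (act (rv c d) u) \<in> ?W" if X: "X \<in> osp_part n m q" and q: "q \<in> {0, 1}" for X q
    unfolding act_commute[OF q parity_01 X rv_osp_part[OF lower.hyps(2,3)]]
    using superbracket_osp[OF q parity_01 X rv_osp_part[OF lower.hyps(2,3)]]
    by (intro span_add span_scale * lower.IH osp_part_osp[OF X q])
  moreover obtain X0 X1 where X: "X = X0 + X1" "X0 \<in> osp_part n m 0" "X1 \<in> osp_part n m 1"
    using lower.prems by (auto simp: osp_def)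
  moreover have "X0 \<in> osp n m" "X1 \<in> osp n m"
    using X by (auto intro: osp_part_osp)
  ultimately show ?case
    unfolding \<open>X = X0 + X1\<close> by (subst act_add) (auto intro: span_add)
qed

text \<open>\<open>rv b p\<close> has degree zero for y, so its bracket with a raising root vector
  is a combination of root vectors of the same positive degree, all of which kill v.\<close>

lemma singular_act:
  assumes v: "singular y v" and p: "p \<in> labels n m" and b: "b \<in> labels n m"
    and eq: "lval y p = lval y b"
  shows "singular y (act (rv b p) v)"
  unfolding singular_def
proof (intro ballI impI)
  fix c d assume cd: "c \<in> labels n m" "d \<in> labels n m" "lval y d < lval y c"
  let ?Z = "superbracket n m ((parity c + parity d) mod 2) ((parity b + parity p) mod 2) (rv c d) (rv b p)"
  have Z: "?Z \<in> osp n m"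
    using cd p b by (intro superbracket_osp parity_01 rv_osp_part)
  have "act ?Z v \<in> {0}"
  proof (rule act_mem[OF Z subspace_single_0])
    fix i j assume ij: "i \<in> labels n m" "j \<in> labels n m" "?Z i j \<noteq> 0"
    have "lval y i - lval y j = (lval y c - lval y d) + (lval y b - lval y p)"
      by (rule superbracket_difference[OF rv_difference rv_difference ij(3)])
    then show "act (rv i j) v \<in> {0}" using v cd(3) eq ij by (simp add: singular_def)
  qed
  then show "act (rv c d) (act (rv b p) v) = 0"
    unfolding act_commute[OF parity_01 parity_01 rv_osp_part[OF cd(1,2)] rv_osp_part[OF b p]]
    using v cd act_vzero[OF rv_osp[OF b p]] by (simp add: singular_def)
qed

lemma act_rv_bar:
  assumes "c \<in> labels n m" "d \<in> labels n m" "act (rv c d) v = 0"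
  shows "act (rv (bar d) (bar c)) v = 0"
  using assms by (simp add: rv_bar act_scale rv_osp)

lemma act_rv_long:
  assumes p: "p \<in> labels n m" "p \<noteq> Zero" and v: "act (rv p Zero) v = 0"
  shows "act (rv p (bar p)) v = 0"
  using rv_long[OF p]
proof
  assume "parity p = 0 \<and> rv p (bar p) = mat_scale (sg p Zero) (superbracket n m 1 1 (rv p Zero) (rv p Zero))"
  moreover from this have E: "rv p Zero \<in> osp_part n m 1"
    using rv_osp_part[OF p(1), of Zero] by simp
  moreover have "superbracket n m 1 1 (rv p Zero) (rv p Zero) \<in> osp n m"
    using E by (intro superbracket_osp) auto
  moreover have "act (superbracket n m 1 1 (rv p Zero) (rv p Zero)) v = 0"
    using act_bracket[OF _ _ E E] v act_vzero[OF rv_osp[OF p(1)]] by simp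
  ultimately show ?thesis by (simp add: act_scale)
qed simp

end

section \<open>Uniqueness of the highest weight and reflection in a simple root\<close>

locale irreducible_osp_module = osp_module +
  assumes irreducible: "submodule scale n m V act W \<Longrightarrow> W = {0} \<or> W = UNIV"
begin

text \<open>The span is a submodule by \<open>act_descendant\<close>. It is graded because v is
  homogeneous and each root vector preserves homogeneity.\<close>

lemma span_descendants:
  assumes "v \<noteq> 0" "homogeneous v" "weight_vector \<mu> v" "singular y v"
    and inj: "inj_on (lval y) (labels n m)"
  shows "span {u. \<exists>k. descendant y v k u} = UNIV"
proof -
  let ?W = "span {u. \<exists>k. descendant y v k u}"
  have "\<exists>a\<in>?W \<inter> V 0. \<exists>b\<in>?W \<inter> V 1. w = a + b" if "w \<in> ?W" for w
    using that
  proof (induction rule: span_induct_alt)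
    case base
    have "0 \<in> ?W \<inter> V 0" "0 \<in> ?W \<inter> V 1"
      using subspace_0 subspace_even subspace_odd span_zero by auto
    then show ?case by (metis add_0)
  next
    case (step c x w)
    then obtain a b where ab: "a \<in> ?W \<inter> V 0" "b \<in> ?W \<inter> V 1" "w = a + b" by blast
    have sub: "subspace (?W \<inter> V 0)" "subspace (?W \<inter> V 1)"
      using subspace_even subspace_odd by (auto intro: subspace_inter)
    have x: "x \<in> ?W" using step descendant_span by blast
    have "homogeneous x" using step descendant_homogeneous assms(2) by auto
    then consider "x \<in> V 0" | "x \<in> V 1" by (auto simp: homogeneous_def)
    then show ?case
    proof cases
      case 1
      then have "scale c x + a \<in> ?W \<inter> V 0"
        using ab x by (intro subspace_add[OF sub(1)] subspace_scale[OF sub(1)]) auto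
      moreover have "scale c x + w = (scale c x + a) + b"
        using ab by (simp add: add.assoc)
      ultimately show ?thesis using ab by blast
    next
      case 2
      then have "scale c x + b \<in> ?W \<inter> V 1"
        using ab x by (intro subspace_add[OF sub(2)] subspace_scale[OF sub(2)]) auto
      moreover have "scale c x + w = a + (scale c x + b)"
        using ab by (simp add: add.left_commute)
      ultimately show ?thesis using ab by blast
    qed
  qed
  moreover have "act X w \<in> ?W" if "X \<in> osp n m" "w \<in> ?W" for X w
    using that(2)
  proof (induction rule: span_induct_alt)
    case base
    then show ?case using act_vzero[OF that(1)] by (simp add: span_zero)
  next
    case (step c x w)
    then have "act X x \<in> ?W" using act_descendant[OF _ assms(3,4) inj that(1)] by blast
    with step show ?case
      by (simp add: act_vadd[OF that(1)] act_vscale[OF that(1)] span_add span_scale)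
  qed
  ultimately have "submodule scale n m V act ?W"
    unfolding submodule_def using subspace_span by blast
  moreover have "v \<in> ?W" by (rule descendant_span[OF descendant.self])
  ultimately show ?thesis using irreducible assms(1) by blast
qed

text \<open>Each of v and w generates the module, so each eigenvalue of the grading element arises
  from the other by subtracting a natural number and the two are equal. Then w has no component
  below the top degree and is a multiple of v.\<close>

lemma singular_unique:
  assumes v: "v \<noteq> 0" "homogeneous v" "weight_vector \<mu> v" "singular y v"
    and w: "w \<noteq> 0" "homogeneous w" "weight_vector \<nu> w" "singular y w"
    and inj: "inj_on (lval y) (labels n m)" and x: "x \<in> axes n m"
  shows "\<mu> x = \<nu> x"
proof -
  let ?H = "grading_element y"
  let ?e = "\<lambda>\<mu>. weight_eval n m \<mu> ?H"
  have H: "?H \<in> osp n m" using grading_element_cartan by (simp add: cartan_def)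
  have le: "\<exists>k::nat. ?e \<nu> = ?e \<mu> - of_nat k"
    if v: "v \<noteq> 0" "homogeneous v" "weight_vector \<mu> v" "singular y v"
      and w: "w \<noteq> 0" "weight_vector \<nu> w" for v w \<mu> \<nu>
  proof (rule eigenvalue_of_span[OF act_hom[OF H]])
    show "w \<in> span {u. \<exists>k. descendant y v k u}" using span_descendants[OF v inj] by simp
    show "act ?H w = scale (?e \<nu>) w" using w(2) grading_element_cartan by (simp add: weight_vector_def)
  qed (use w descendant_eigenvector v in auto)
  obtain k k' :: nat where "?e \<nu> = ?e \<mu> - of_nat k" "?e \<mu> = ?e \<nu> - of_nat k'"
    using le[OF v w(1,3)] le[OF w v(1,3)] by blast
  \<comment> \<open>The two natural numbers are opposite differences, so they add up to 0 and both
    vanish.\<close>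
  then have "of_nat k = ?e \<mu> - ?e \<nu>" "of_nat k' = ?e \<nu> - ?e \<mu>" by algebra+
  then have "of_nat (k + k') = (0 :: complex)" by simp
  then have "k = 0" by (metis add_is_0 of_nat_eq_0_iff)
  then have eq: "?e \<nu> = ?e \<mu>" using \<open>?e \<nu> = ?e \<mu> - of_nat k\<close> by simp
  \<comment> \<open>Apart from v, all descendants have an eigenvalue at most one below that of v.
    The part of w in their span has the eigenvalue of v itself, hence is zero by
    \<open>eigenvalue_of_span\<close>.\<close>
  let ?S = "{u. \<exists>k. descendant y v (Suc k) u}"
  have "{u. \<exists>k. descendant y v k u} \<subseteq> insert v ?S"
    using descendant_zero by (auto, metis not0_implies_Suc)
  then have "w \<in> span (insert v ?S)"
    using span_descendants[OF v inj] span_mono by blast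
  then obtain a where a: "w - scale a v \<in> span ?S"
    by (auto simp: span_breakdown_eq)
  have "w - scale a v = 0"
  proof (rule ccontr)
    assume "w - scale a v \<noteq> 0"
    moreover have "act ?H (w - scale a v) = scale (?e \<mu>) (w - scale a v)"
    proof -
      have "act ?H w = scale (?e \<mu>) w" "act ?H v = scale (?e \<mu>) v"
        using w(3) v(3) grading_element_cartan eq by (simp_all add: weight_vector_def)
      then show ?thesis by (simp add: act_vdiff[OF H] act_vscale[OF H] algebra_simps)
    qed
    moreover have "\<exists>k::nat. act ?H u = scale ((?e \<mu> - 1) - of_nat k) u" if u: "u \<in> ?S" for u
    proof -
      obtain k where "descendant y v (Suc k) u" using u by blast
      from descendant_eigenvector[OF this v(3)] show ?thesis
        by (intro exI[of _ k]) (simp add: algebra_simps)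
    qed
    ultimately have "\<exists>k::nat. ?e \<mu> = (?e \<mu> - 1) - of_nat k"
      using a by (intro eigenvalue_of_span[OF act_hom[OF H], of ?S]) auto
    then obtain k :: nat where "(1 + of_nat k :: complex) = 0"
      by (auto simp: algebra_simps)
    then show False by (metis of_nat_Suc of_nat_eq_0_iff old.nat.distinct(2))
  qed
  then have wv: "w = scale a v" by simp
  let ?T = "rv (Pos x) (Pos x)"
  have T: "?T \<in> cartan n m" using x rv_diag_cartan by simp
  then have "?T \<in> osp n m" by (simp add: cartan_def)
  have "weight_eval n m \<mu> ?T = \<mu> x" "weight_eval n m \<nu> ?T = \<nu> x"
    using x by (simp_all add: weight_eval_rv_diag)
  then have "act ?T w = scale (\<nu> x) w" "act ?T v = scale (\<mu> x) v"
    using w(3) v(3) T by (simp_all add: weight_vector_def)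
  moreover have "act ?T w = scale a (act ?T v)"
    unfolding wv by (rule act_vscale[OF \<open>?T \<in> osp n m\<close>])
  ultimately have "scale (\<nu> x) w = scale (\<mu> x) w"
    by (simp add: wv mult.commute)
  then show ?thesis using w(1) by simp
qed

text \<open>Reflection of a singular vector in the simple root \<open>wt p - wt b\<close>. On the wall \<open>y0\<close> between the
  orderings \<open>y\<close> and \<open>y'\<close> the labels \<open>p\<close> and \<open>b\<close> coincide. The coefficients \<open>c\<close> are determined by
  \<open>E F\<^sup>k v = c\<^sub>k F\<^sup>k\<^sup>-\<^sup>1 v\<close> for \<open>E = rv p b\<close> and \<open>F = rv b p\<close>, so \<open>F\<^sup>r\<^sup>+\<^sup>1 v\<close> is again singular
  for \<open>y\<close> and hence zero, while \<open>F\<^sup>r v\<close> is singular for \<open>y'\<close>.\<close>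

lemma singular_reflection:
  fixes y y0 y' :: "axis \<Rightarrow> int" and c :: "nat \<Rightarrow> complex"
  assumes v: "v \<noteq> 0" "homogeneous v" "weight_vector \<mu> v" "singular y v"
    and inj: "inj_on (lval y) (labels n m)"
    and p: "p \<in> labels n m" "p \<noteq> Zero" and b: "b \<in> labels n m" "p \<noteq> b" "p \<noteq> bar b"
    and wall: "lval y0 p = lval y0 b"
    and y0y: "\<And>i j. i \<in> labels n m \<Longrightarrow> j \<in> labels n m \<Longrightarrow> lval y0 j < lval y0 i \<Longrightarrow> lval y j < lval y i"
    and yy0: "\<And>i j. i \<in> labels n m \<Longrightarrow> j \<in> labels n m \<Longrightarrow> lval y j < lval y i \<Longrightarrow>
      lval y0 j < lval y0 i \<or> (i = p \<and> j = b) \<or> (i = bar b \<and> j = bar p) \<or> (b = Zero \<and> i = p \<and> j = bar p)"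
    and y'y0: "\<And>i j. i \<in> labels n m \<Longrightarrow> j \<in> labels n m \<Longrightarrow> lval y' j < lval y' i \<Longrightarrow>
      lval y0 j < lval y0 i \<or> (i = b \<and> j = p) \<or> (i = bar p \<and> j = bar b) \<or> (b = Zero \<and> i = bar p \<and> j = p)"
    and s: "s = (-1) ^ ((parity p + parity b) mod 2)"
    and c0: "c 0 = 0"
    and cS: "\<And>k. c (Suc k) = s * c k + (lval \<mu> p - s * lval \<mu> b - of_nat k * (if b = Zero then 1 else 1 + s))"
    and r: "c (Suc r) = 0" "\<And>k. 1 \<le> k \<Longrightarrow> k \<le> r \<Longrightarrow> c k \<noteq> 0"
  shows "\<exists>w. w \<noteq> 0 \<and> homogeneous w \<and>
    weight_vector (\<mu> + weight_scale (of_nat r) (wt b - wt p)) w \<and> singular y' w"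
proof -
  define q where "q = (parity p + parity b) mod 2"
  have q: "q \<in> {0, 1}" by (auto simp: q_def)
  define E where "E = rv p b"
  define F where "F = rv b p"
  define h where "h = rv p p - mat_scale s (rv b b)"
  define \<nu> where "\<nu> k = \<mu> + weight_scale (of_nat k) (wt b - wt p)" for k :: nat
  define u where "u k = (act F ^^ k) v" for k
  have u0: "u 0 = v" and uS: "u (Suc k) = act F (u k)" for k
    by (simp_all add: u_def)
  have E: "E \<in> osp_part n m q" and F: "F \<in> osp_part n m q"
    using rv_osp_part[OF p(1) b(1)] rv_osp_part[OF b(1) p(1)] by (simp_all add: E_def F_def q_def add.commute)
  have Eo: "E \<in> osp n m" and Fo: "F \<in> osp n m"
    using E F q osp_part_osp by blast+
  have EF: "superbracket n m q q E F = h"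
    using bracket_opposite[OF p(1) b(1,3) q_def] by (simp add: E_def F_def h_def s q_def)
  have ho: "h \<in> osp n m" using superbracket_osp[OF q q E F] EF by simp
  have "h i j = 0" if "i \<noteq> j" for i j
    using that by (auto simp: h_def rv_def mat_scale_def)
  then have h: "h \<in> cartan n m" using ho by (auto simp: cartan_def)
  have \<nu>S: "\<nu> (Suc k) = \<nu> k + wt b - wt p" for k
    by (auto simp: \<nu>_def weight_scale_def fun_eq_iff algebra_simps)
  have wu: "weight_vector (\<nu> k) (u k)" for k
  proof (induction k)
    case 0
    have "\<nu> 0 = \<mu>" by (auto simp: \<nu>_def weight_scale_def fun_eq_iff)
    then show ?case using v(3) by (simp add: u0)
  next
    case (Suc k)
    then show ?case using weight_vector_rv[OF Suc b(1) p(1)] by (simp only: \<nu>S uS F_def)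
  qed
  have hu: "homogeneous (u k)" for k
    by (induction k) (auto simp: u0 uS F_def v intro: homogeneous_rv b p)
  have su: "singular y0 (u k)" for k
  proof (induction k)
    case 0
    show ?case using v(4) y0y by (auto simp: singular_def u0)
  next
    case (Suc k)
    then show ?case using singular_act[OF Suc p(1) b(1) wall] by (simp add: uS F_def)
  qed
  have hp: "h p p = 1"
    using p b by (auto simp: h_def rv_def mat_scale_def)
  have hb: "h b b = (if b = Zero then 0 else - s)"
    using b by (auto simp: h_def rv_def mat_scale_def)
  have e0: "weight_eval n m \<mu> h = lval \<mu> p - s * lval \<mu> b"
  proof -
    have "weight_eval n m \<mu> h = weight_eval n m \<mu> (rv p p) - s * weight_eval n m \<mu> (rv b b)"
      by (simp add: weight_eval_def h_def mat_scale_def sum_subtractf sum_distrib_left algebra_simps)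
    then show ?thesis using p b by (simp add: weight_eval_rv_diag)
  qed
  \<comment> \<open>Each application of F adds wt b - wt p to the weight, and the value of this root
    at h is \<open>h b b - h p p\<close>: it is -s - 1 in general and -1 for b = Zero. This is the
    origin of the case distinction in the recursion for \<open>c\<close>.\<close>
  have ek: "weight_eval n m (\<nu> k) h
      = lval \<mu> p - s * lval \<mu> b - of_nat k * (if b = Zero then 1 else 1 + s)" for k
  proof (induction k)
    case 0
    have "\<nu> 0 = \<mu>" by (auto simp: \<nu>_def weight_scale_def fun_eq_iff)
    then show ?case by (simp add: e0)
  next
    case (Suc k)
    then show ?case
      unfolding \<nu>S weight_eval_add weight_eval_diff weight_eval_wt[OF h p(1)] weight_eval_wt[OF h b(1)]
        hp hb Suc by (simp add: algebra_simps)
  qed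
  have s': "s = (-1) ^ (q * q)" using q by (auto simp: s q_def)
  have step: "act E (u (Suc k)) = scale s (act F (act E (u k))) + scale (weight_eval n m (\<nu> k) h) (u k)" for k
  proof -
    have "act E (u (Suc k)) = scale s (act F (act E (u k))) + act h (u k)"
      unfolding uS s' EF[symmetric] by (rule act_commute[OF q q E F])
    then show ?thesis using wu[of k] h by (simp add: weight_vector_def)
  qed
  have yb: "lval y b < lval y p"
  proof (rule ccontr)
    assume "\<not> lval y b < lval y p"
    then have "lval y p < lval y b" using inj_onD[OF inj _ p(1) b(1)] b(2) by fastforce
    from yy0[OF b(1) p(1) this] show False using wall b p by auto
  qed
  have Ev: "act E (u 0) = 0" using v(4) p b yb by (simp add: singular_def E_def u0)
  have Eu: "act E (u (Suc k)) = scale (c (Suc k)) (u k)" for k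
  proof (induction k)
    case 0
    show ?case unfolding step Ev ek cS c0 by (simp add: act_vzero[OF Fo])
  next
    case (Suc k)
    show ?case unfolding step[of "Suc k"] Suc ek cS[of "Suc k"]
      by (simp add: act_vscale[OF Fo] uS scale_left_distrib)
  qed
  have nz: "u k \<noteq> 0" if "k \<le> r" for k
    using that
  proof (induction k)
    case 0
    show ?case using v(1) by (simp add: u0)
  next
    case (Suc k)
    then have "act E (u (Suc k)) \<noteq> 0" using r(2)[of "Suc k"] by (simp add: Eu)
    then show ?case using act_vzero[OF Eo] by metis
  qed
  have last: "u (Suc r) = 0"
  proof (rule ccontr)
    assume nz: "u (Suc r) \<noteq> 0"
    have E0: "act (rv p b) (u (Suc r)) = 0" using Eu[of r] r(1) by (simp add: E_def)
    have "singular y (u (Suc r))"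
      unfolding singular_def
    proof (intro ballI impI)
      \<comment> \<open>Root vectors raising for y but not for the wall are E, its multiple at (bar
        b, bar p) and, for b = Zero, the long root vector. All of them kill the vector as soon as E
        does.\<close>
      fix i j assume ij: "i \<in> labels n m" "j \<in> labels n m" "lval y j < lval y i"
      from yy0[OF this] show "act (rv i j) (u (Suc r)) = 0"
        using su[of "Suc r"] ij E0 act_rv_bar[OF p(1) b(1) E0] act_rv_long[OF p] by (auto simp: singular_def)
    qed
    then have eq: "\<mu> x = \<nu> (Suc r) x" if "x \<in> axes n m" for x
      using singular_unique[OF v nz hu wu _ inj that] by blast
    \<comment> \<open>On the axis of p the root wt b - wt p does not vanish, b being on another axis
      or \<open>Zero\<close>. It is multiplied by r + 1, which is never 0, so the two weights cannot
      agree.\<close>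
    obtain x where x: "p = Pos x \<or> p = Neg x" using p(2) by (cases p) auto
    then have "x \<in> axes n m" using p(1) by auto
    from eq[OF this] have "of_nat (Suc r) * (wt b x - wt p x) = 0"
      by (simp add: \<nu>_def weight_scale_def)
    moreover have "wt b x = 0" "wt p x \<noteq> 0"
      using x b by (auto simp: wt_def)
    ultimately show False by (simp del: of_nat_Suc)
  qed
  have F0: "act (rv b p) (u r) = 0" using last by (simp add: uS F_def)
  have "singular y' (u r)"
    unfolding singular_def
  proof (intro ballI impI)
    fix i j assume ij: "i \<in> labels n m" "j \<in> labels n m" "lval y' j < lval y' i"
    \<comment> \<open>For b = Zero the ordering y' also raises along (bar p, p). That long root
      vector is reached from \<open>rv (bar p) Zero\<close>, a multiple of F.\<close>
    have "b = Zero \<Longrightarrow> act (rv (bar p) p) (u r) = 0"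
      using act_rv_long[of "bar p" "u r"] act_rv_bar[OF b(1) p(1) F0] p by simp
    with y'y0[OF ij] show "act (rv i j) (u r) = 0"
      using su[of r] ij F0 act_rv_bar[OF b(1) p(1) F0] by (auto simp: singular_def)
  qed
  then show ?thesis using nz[of r] hu[of r] wu[of r] unfolding \<nu>_def by blast
qed

end

section \<open>Orderings of the weights and block Frobenius coordinates\<close>

fun axis_of :: "label \<Rightarrow> axis" where
  "axis_of (Pos x) = x"
| "axis_of (Neg x) = x"
| "axis_of Zero = undefined"

text \<open>A Borel subalgebra is represented by the list of those labels on which its ordering is
  positive, in decreasing order. The function \<open>height L\<close> realises this ordering.\<close>

definition ordering :: "nat \<Rightarrow> nat \<Rightarrow> label list \<Rightarrow> bool" where
  "ordering n m L \<longleftrightarrow> Zero \<notin> set L \<and> distinct (map axis_of L) \<and> axis_of ` set L = axes n m"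

fun height :: "label list \<Rightarrow> axis \<Rightarrow> int" where
  "height [] = (\<lambda>_. 0)"
| "height (Pos x # L) = (height L)(x := int (length L) + 1)"
| "height (Neg x # L) = (height L)(x := - (int (length L) + 1))"
| "height (Zero # L) = height L"

text \<open>The labels seen by a list, in a form that survives induction: tails of an ordering miss
  some axes and are not orderings themselves.\<close>

definition spread :: "label list \<Rightarrow> label set" where
  "spread L = insert Zero (set L \<union> bar ` set L)"

section \<open>Heights of labels and moves between orderings\<close>

lemma axis_of_bar [simp]: "axis_of (bar a) = axis_of a"
  by (cases a) auto

lemma axis_of_eq_iff: "a \<noteq> Zero \<Longrightarrow> b \<noteq> Zero \<Longrightarrow> axis_of a = axis_of b \<longleftrightarrow> a = b \<or> a = bar b"
  by (cases a; cases b) auto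

lemma labels_ordering:
  assumes "ordering n m L"
  shows "labels n m = spread L"
proof (intro equalityI subsetI)
  fix c assume c: "c \<in> labels n m"
  show "c \<in> spread L"
  proof (cases "c = Zero")
    case False
    then have "axis_of c \<in> axes n m" using c by (cases c) auto
    then obtain a where a: "a \<in> set L" "axis_of a = axis_of c"
      using assms by (metis imageE ordering_def)
    then have "a \<noteq> Zero" using assms by (auto simp: ordering_def)
    then have "c = a \<or> c = bar a" using axis_of_eq_iff[of c a] a False by auto
    then show ?thesis using a by (auto simp: spread_def)
  qed (simp add: spread_def)
next
  fix c assume "c \<in> spread L"
  then consider "c = Zero" | a where "a \<in> set L" "c = a \<or> c = bar a" by (auto simp: spread_def)
  then show "c \<in> labels n m"
  proof cases
    case 2
    then have "axis_of a \<in> axes n m" "a \<noteq> Zero" using assms by (auto simp: ordering_def)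
    then have "a \<in> labels n m" by (cases a) auto
    then show ?thesis using 2(2) bar_labels by blast
  qed simp
qed

lemma height_Cons:
  "a \<noteq> Zero \<Longrightarrow> lval (height (a # L)) c =
    (if c = a then int (length L) + 1 else if c = bar a then - (int (length L) + 1) else lval (height L) c)"
  by (cases a; cases c) auto

lemma height_bound: "\<bar>lval (height L) c\<bar> \<le> int (length L)"
proof (induction L)
  case Nil
  then show ?case by (cases c) auto
next
  case (Cons a L)
  show ?case
  proof (cases "a = Zero")
    case False
    then show ?thesis using Cons unfolding height_Cons[OF False] by auto
  qed (use Cons in auto)
qed

lemma spread_Cons: "c \<in> spread (a # L) \<longleftrightarrow> c = a \<or> c = bar a \<or> c \<in> spread L"
  by (auto simp: spread_def)

lemma inj_on_height:
  "Zero \<notin> set L \<Longrightarrow> distinct (map axis_of L) \<Longrightarrow> inj_on (lval (height L)) (spread L)"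
proof (induction L)
  case Nil
  then show ?case by (simp add: spread_def)
next
  case (Cons a L)
  then have a: "a \<noteq> Zero" and IH: "inj_on (lval (height L)) (spread L)" by auto
  show ?case
  proof (rule inj_onI)
    fix c d assume cd: "c \<in> spread (a # L)" "d \<in> spread (a # L)"
      and eq: "lval (height (a # L)) c = lval (height (a # L)) d"
    show "c = d"
      using eq cd inj_onD[OF IH, of c d] height_bound[of L c] height_bound[of L d]
      unfolding height_Cons[OF a] spread_Cons by (auto split: if_splits)
  qed
qed

lemma inj_on_height_ordering: "ordering n m L \<Longrightarrow> inj_on (lval (height L)) (labels n m)"
  using inj_on_height labels_ordering by (auto simp: ordering_def)

text \<open>Heights count positions from the end, so exchanging two neighbours permutes two adjacent
  values and their negatives. Describing the change by values rather than by labels turns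
  comparisons on the wall into integer arithmetic.\<close>

lemma height_swap:
  assumes "Zero \<notin> set (xs @ p # b # ys)" "distinct (map axis_of (xs @ p # b # ys))"
  shows "lval (height (xs @ b # p # ys)) c =
    (let h = lval (height (xs @ p # b # ys)) c; k = int (length ys) in
     if h = k + 2 then k + 1 else if h = k + 1 then k + 2
     else if h = - (k + 1) then - (k + 2) else if h = - (k + 2) then - (k + 1) else h)"
  using assms
proof (induction xs)
  case Nil
  then have "p \<noteq> Zero" "b \<noteq> Zero" "b \<noteq> p" "b \<noteq> bar p" "p \<noteq> bar b" "bar b \<noteq> bar p" by auto
  then show ?case using height_bound[of ys c] by (auto simp: height_Cons Let_def)
next
  case (Cons a xs)
  then have "a \<noteq> Zero" by auto
  then show ?case using Cons by (simp add: height_Cons Let_def)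
qed

lemma height_flip:
  assumes "Zero \<notin> set (xs @ [p])"  "distinct (map axis_of (xs @ [p]))"
  shows "lval (height (xs @ [bar p])) c =
    (let h = lval (height (xs @ [p])) c in if h = 1 then - 1 else if h = - 1 then 1 else h)"
  using assms
proof (induction xs)
  case Nil
  then have "p \<noteq> Zero" "bar p \<noteq> Zero" "bar p \<noteq> p" by auto
  then show ?case using height_bound[of "[]" c] by (auto simp: height_Cons Let_def)
next
  case (Cons a xs)
  then have "a \<noteq> Zero" by auto
  then show ?case using Cons by (simp add: height_Cons Let_def)
qed

lemma height_middle:
  assumes "Zero \<notin> set (xs @ p # ys)" "distinct (map axis_of (xs @ p # ys))"
  shows "lval (height (xs @ p # ys)) p = int (length ys) + 1"
  using assms
proof (induction xs)
  case Nil
  then show ?case by (auto simp: height_Cons)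
next
  case (Cons a xs)
  then have "a \<noteq> Zero" "p \<noteq> a" "p \<noteq> bar a" by auto
  then show ?case using Cons by (auto simp: height_Cons)
qed

text \<open>Selection sort: \<open>front\<close> carries the required next entry to the front by
  adjacent exchanges, and the prefix xs collects what is already in place.\<close>

lemma adjacent_swaps_perm:
  assumes swap: "\<And>xs a b ys. P (xs @ a # b # ys) \<Longrightarrow> P (xs @ b # a # ys)"
    and "mset K = mset L" "P K"
  shows "P L"
proof -
  have front: "P (xs @ a # us @ vs)" if "P (xs @ us @ a # vs)" for xs us a vs
    using that
  proof (induction us arbitrary: xs)
    case (Cons b us)
    then have "P ((xs @ [b]) @ a # us @ vs)" by (intro Cons.IH) simp
    then show ?case using swap[of xs b a "us @ vs"] by simp
  qed simp
  have "P (xs @ L)" if "P (xs @ K)" "mset K = mset L" for xs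
    using that
  proof (induction L arbitrary: xs K)
    case (Cons a L)
    then have "a \<in> set K" by (metis list.set_intros(1) mset_eq_setD)
    then obtain us vs where K: "K = us @ a # vs" by (meson split_list)
    then have "P ((xs @ [a]) @ us @ vs)" using front Cons.prems(1) by auto
    moreover have "mset (us @ vs) = mset L" using Cons.prems(2) K by simp
    ultimately show ?case using Cons.IH[of "xs @ [a]" "us @ vs"] by simp
  qed simp
  from this[of "[]"] show ?thesis using assms by simp
qed

text \<open>Any entry changes its sign by being carried to the end, flipped there and carried back.
  Once all signs agree with those in L, only a permutation is left.\<close>

lemma orderings_connected:
  assumes swap: "\<And>xs a b ys. P (xs @ a # b # ys) \<Longrightarrow> P (xs @ b # a # ys)"
    and flip: "\<And>xs a. P (xs @ [a]) \<Longrightarrow> P (xs @ [bar a])"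
    and K: "ordering n m K" and L: "ordering n m L" and "P K"
  shows "P L"
proof -
  have flip': "P (xs @ bar a # ys)" if "P (xs @ a # ys)" for xs a ys
  proof -
    have "P ((xs @ ys) @ [a])" by (rule adjacent_swaps_perm[where P = P, OF _ _ that]) (auto intro: swap)
    then have "P ((xs @ ys) @ [bar a])" by (rule flip)
    then show ?thesis
      by (rule adjacent_swaps_perm[where P = P, rotated 2]) (auto intro: swap)
  qed
  \<comment> \<open>Both lists contain exactly one label on each axis, so the entry of L on the axis
    of a is a or bar a; \<open>?g\<close> picks it.\<close>
  let ?g = "\<lambda>a. if a \<in> set L then a else bar a"
  have "P (xs @ map ?g K)" if "P (xs @ K)" for xs
    using that
  proof (induction K arbitrary: xs)
    case (Cons a K)
    then have "P ((xs @ [?g a]) @ K)" using flip' by auto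
    from Cons.IH[OF this] show ?case by simp
  qed simp
  from this[of "[]"] have "P (map ?g K)" using \<open>P K\<close> by simp
  moreover have "mset (map ?g K) = mset L"
  proof -
    have ax: "map axis_of (map ?g K) = map axis_of K" by simp
    then have "distinct (map ?g K)" using K by (metis distinct_map ordering_def)
    moreover have "distinct L" using L by (auto simp: ordering_def distinct_map)
    moreover have "?g a \<in> set L" if a: "a \<in> set K" for a
    proof -
      have "axis_of a \<in> axis_of ` set L" using K L a by (auto simp: ordering_def)
      then obtain b where b: "b \<in> set L" "axis_of a = axis_of b" by blast
      moreover have "a \<noteq> Zero" "b \<noteq> Zero" using K L a b by (auto simp: ordering_def)
      ultimately have "a = b \<or> a = bar b" by (simp add: axis_of_eq_iff)
      then show ?thesis using b by auto
    qed
    then have "set (map ?g K) \<subseteq> set L" unfolding set_map by blast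
    moreover have "card (set (map ?g K)) = card (set L)"
    proof -
      have "card (set (map ?g K)) = card (axes n m)" "card (set L) = card (axes n m)"
        using K L calculation distinct_card[of "map axis_of K"] distinct_card[of "map axis_of L"]
          distinct_card[of "map ?g K"] distinct_card[of L]
        by (auto simp: ordering_def)
      then show ?thesis by simp
    qed
    ultimately show ?thesis
      by (metis List.finite_set card_subset_eq set_eq_iff_mset_eq_distinct)
  qed
  ultimately show ?thesis using adjacent_swaps_perm[of P, OF swap] by blast
qed

lemma lval_add: "lval (f + g) a = lval f a + (lval g a :: 'a::ab_group_add)"
  by (cases a) auto

lemma lval_weight_scale: "lval (weight_scale z \<mu>) a = z * lval \<mu> a"
  by (cases a) (auto simp: weight_scale_def)

lemma lval_wt_self: "a \<noteq> Zero \<Longrightarrow> lval (wt a) a = 1"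
  by (cases a) (auto simp: wt_def)

lemma lval_wt_other: "a \<noteq> Zero \<Longrightarrow> b \<noteq> Zero \<Longrightarrow> axis_of a \<noteq> axis_of b \<Longrightarrow> lval (wt a) b = 0"
  by (cases a; cases b) (auto simp: wt_def)

section \<open>Partitions and coordinates attached to list positions\<close>

lemma partition_antimono: "partition l \<Longrightarrow> 1 \<le> i \<Longrightarrow> i \<le> k \<Longrightarrow> l k \<le> l i"
proof (induction k)
  case (Suc k)
  show ?case
  proof (cases "i = Suc k")
    case False
    then have "l (k + 1) \<le> l k" "l k \<le> l i" using Suc by (auto simp: partition_def)
    then show ?thesis by simp
  qed simp
qed simp

text \<open>Both sides say that the box in row i and column j belongs to the diagram: a column
  occupies an initial segment of rows, so its length is its last row.\<close>

lemma le_conjugate_iff: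
  assumes l: "partition l" and "1 \<le> i" "1 \<le> j"
  shows "i \<le> conjugate l j \<longleftrightarrow> j \<le> l i"
proof -
  let ?S = "{i. 1 \<le> i \<and> j \<le> l i}"
  have fin: "finite ?S"
    by (rule finite_subset[of _ "{i. 1 \<le> i \<and> l i \<noteq> 0}"]) (use l assms in \<open>auto simp: partition_def\<close>)
  show ?thesis
  proof (cases "j \<le> l i")
    case True
    then have "{1..i} \<subseteq> ?S" using partition_antimono[OF l, of _ i] by (auto intro: le_trans)
    from card_mono[OF fin this] show ?thesis using True by (simp add: conjugate_def)
  next
    case False
    then have "?S \<subseteq> {1..<i}" using partition_antimono[OF l \<open>1 \<le> i\<close>]
      by (auto simp: not_le[symmetric] intro: le_trans)
    from card_mono[OF _ this] show ?thesis using False assms by (simp add: conjugate_def)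
  qed
qed

lemma conjugate_antimono:
  assumes "partition l" "1 \<le> j" "j \<le> k"
  shows "conjugate l k \<le> conjugate l j"
proof (cases "conjugate l k = 0")
  case False
  then have "k \<le> l (conjugate l k)" using le_conjugate_iff[of l "conjugate l k" k] assms by auto
  then show ?thesis using le_conjugate_iff[of l "conjugate l k" j] assms False by auto
qed simp

text \<open>Removing the first n rows shortens each column by n. Truncated subtraction covers the
  columns that disappear and later matches the maximum with 0 in \<open>frob_q\<close>.\<close>

lemma conjugate_shift:
  assumes l: "partition l" and j: "1 \<le> j"
  shows "conjugate (\<lambda>k. l (n + k)) j = conjugate l j - n"
proof -
  have "inj_on ((+) n) {i. 1 \<le> i \<and> l (n + i) \<noteq> 0}" by (simp add: inj_on_def)
  moreover have "(+) n ` {i. 1 \<le> i \<and> l (n + i) \<noteq> 0} \<subseteq> {i. 1 \<le> i \<and> l i \<noteq> 0}" by auto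
  ultimately have "finite {i. 1 \<le> i \<and> l (n + i) \<noteq> 0}"
    using l finite_subset finite_imageD unfolding partition_def by blast
  then have sh: "partition (\<lambda>k. l (n + k))" using l by (auto simp: partition_def)
  have *: "i \<le> conjugate (\<lambda>k. l (n + k)) j \<longleftrightarrow> n + i \<le> conjugate l j" if "1 \<le> i" for i
    using le_conjugate_iff[OF sh that j] le_conjugate_iff[OF l _ j, of "n + i"] that by simp
  show ?thesis
    using *[of "conjugate (\<lambda>k. l (n + k)) j"] *[of "conjugate l j - n"] by linarith
qed

text \<open>The boxes of row d + 1 to the right of column e, or those of column e + 1 below row d.
  Only the parity of the label matters, so the value is unchanged when the label is barred.\<close>

definition frob_coeff :: "(nat \<Rightarrow> nat) \<Rightarrow> nat \<Rightarrow> nat \<Rightarrow> label \<Rightarrow> int" where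
  "frob_coeff l d e a = (if parity a = 0 then max (int (l (Suc d)) - int e) 0
     else max (int (conjugate l (Suc e)) - int d) 0)"

definition parity_count :: "nat \<Rightarrow> label list \<Rightarrow> nat" where
  "parity_count q L = length (filter (\<lambda>a. parity a = q) L)"

text \<open>The arguments \<open>d\<close> and \<open>e\<close> count the $\<delta>$- and $\<epsilon>$-entries preceding the list.\<close>

fun list_weight :: "(nat \<Rightarrow> nat) \<Rightarrow> nat \<Rightarrow> nat \<Rightarrow> label list \<Rightarrow> weight" where
  "list_weight l d e [] = 0"
| "list_weight l d e (a # L) = weight_scale (of_int (frob_coeff l d e a)) (wt a) +
     list_weight l (d + parity_count 0 [a]) (e + parity_count 1 [a]) L"

lemma list_weight_append:
  "list_weight l d e (K @ L) =
     list_weight l d e K + list_weight l (d + parity_count 0 K) (e + parity_count 1 K) L"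
  by (induction K arbitrary: d e) (auto simp: parity_count_def add.assoc)

lemma lval_list_weight_outside:
  "Zero \<notin> set L \<Longrightarrow> a \<noteq> Zero \<Longrightarrow> axis_of a \<notin> axis_of ` set L \<Longrightarrow> lval (list_weight l d e L) a = 0"
proof (induction L arbitrary: d e)
  case Nil
  then show ?case by (cases a) auto
next
  case (Cons b L)
  then have "lval (wt b) a = 0" by (intro lval_wt_other) auto
  then show ?case
    unfolding list_weight.simps lval_add lval_weight_scale using Cons by simp
qed

section \<open>Highest weights of Borel subalgebras\<close>

lemma sum_matrix_apply: "(\<Sum>i\<in>I. Y i) a b = (\<Sum>i\<in>I. (Y i :: mat) a b)"
  by (induction I rule: infinite_finite_induct) auto

lemma wt_weights: "c \<in> labels n m \<Longrightarrow> wt c \<in> weights n m"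
  by (cases c) (auto simp: weights_def wt_def)

lemma wt_inj: "wt a = wt b \<longleftrightarrow> a = b"
proof
  assume eq: "wt a = wt b"
  have "wt a x = wt b x" for x using eq by simp
  from this[of "axis_of a"] this[of "axis_of b"] show "a = b"
    by (cases a; cases b) (auto simp: wt_def split: if_splits)
qed simp

lemma root_space_rv:
  assumes "c \<in> labels n m" "d \<in> labels n m"
  shows "rv c d \<in> root_space n m (wt c - wt d)"
proof -
  have "mat_mult n m H (rv c d) - mat_mult n m (rv c d) H
      = mat_scale (weight_eval n m (wt c - wt d) H) (rv c d)" if H: "H \<in> cartan n m" for H
  proof -
    have "mat_mult n m H (rv c d) - mat_mult n m (rv c d) H = superbracket n m 0 0 H (rv c d)"
      by (simp add: superbracket_def mat_scale_def)
    then show ?thesis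
      unfolding bracket_cartan_rv[OF H assms] weight_eval_diff
      by (simp only: weight_eval_wt[OF H assms(1)] weight_eval_wt[OF H assms(2)])
  qed
  then show ?thesis using rv_osp[OF assms] by (simp add: root_space_def)
qed

text \<open>Testing the eigenvalue equation on the diagonal elements
  \<open>rv (Pos x) (Pos x)\<close> recovers the root coordinate by coordinate, so a single nonzero
  entry determines it.\<close>

lemma root_space_support:
  assumes \<alpha>: "\<alpha> \<in> weights n m" and X: "X \<in> root_space n m \<alpha>" and nz: "X c d \<noteq> 0"
  shows "c \<in> labels n m" "d \<in> labels n m" "\<alpha> = wt c - wt d"
proof -
  have Xo: "X \<in> osp n m" using X by (simp add: root_space_def)
  show cd: "c \<in> labels n m" "d \<in> labels n m" using osp_support[OF Xo nz] by auto
  show "\<alpha> = wt c - wt d"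
  proof
    fix x
    show "\<alpha> x = (wt c - wt d) x"
    proof (cases "x \<in> axes n m")
      case True
      let ?H = "rv (Pos x) (Pos x)"
      have x: "Pos x \<in> labels n m" using True by simp
      have H: "?H \<in> cartan n m" using rv_diag_cartan[OF x] .
      have "(mat_mult n m ?H X - mat_mult n m X ?H) c d = mat_scale (weight_eval n m \<alpha> ?H) X c d"
        using X H by (simp add: root_space_def)
      then have "(?H c c - ?H d d) * X c d = weight_eval n m \<alpha> ?H * X c d"
        using bracket_cartan(2)[OF H Xo, of c d] by (simp add: mat_scale_def)
      then have "weight_eval n m \<alpha> ?H = weight_eval n m (wt c - wt d) ?H"
        using nz unfolding weight_eval_diff weight_eval_wt[OF H cd(1)] weight_eval_wt[OF H cd(2)] by simp
      then show ?thesis unfolding weight_eval_rv_diag[OF x] by simp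
    next
      case False
      then show ?thesis using \<alpha> wt_weights[OF cd(1)] wt_weights[OF cd(2)] by (simp add: weights_def)
    qed
  qed
qed

lemma zero_root_space: "0 \<in> root_space n m \<alpha>"
proof -
  have "mat_mult n m H 0 - mat_mult n m 0 H = mat_scale z 0" for H z
    by (auto simp: mat_mult_def mat_scale_def fun_eq_iff)
  then show ?thesis by (simp add: root_space_def)
qed

lemma root_difference:
  assumes "\<alpha> \<in> roots n m"
  shows "\<exists>c\<in>labels n m. \<exists>d\<in>labels n m. \<alpha> = wt c - wt d"
proof -
  have "root_space n m \<alpha> \<noteq> {0}" "\<alpha> \<in> weights n m" using assms by (auto simp: roots_def)
  then obtain X where X: "X \<in> root_space n m \<alpha>" "X \<noteq> 0" using zero_root_space by blast
  then obtain c d where "X c d \<noteq> 0" by (auto simp: fun_eq_iff)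
  then show ?thesis using root_space_support[OF \<open>\<alpha> \<in> weights n m\<close> X(1)] by blast
qed

lemma finite_roots: "finite (roots n m)"
proof (rule finite_subset)
  show "roots n m \<subseteq> (\<lambda>(c, d). wt c - wt d) ` (labels n m \<times> labels n m)"
    using root_difference by fastforce
qed simp

text \<open>Distinct root spaces have disjoint supports, so a root space contained in the sum of others
  is one of them.\<close>

lemma positive_roots_borel:
  assumes P: "P \<subseteq> roots n m"
    and B: "B = {H + (\<Sum>\<alpha>\<in>P. Y \<alpha>) | H Y. H \<in> cartan n m \<and> (\<forall>\<alpha>\<in>P. Y \<alpha> \<in> root_space n m \<alpha>)}"
  shows "positive_roots n m B = P"
proof (intro equalityI subsetI)
  fix \<alpha> assume "\<alpha> \<in> positive_roots n m B"
  then have \<alpha>: "\<alpha> \<in> weights n m" "\<alpha> \<noteq> 0" "root_space n m \<alpha> \<noteq> {0}" "root_space n m \<alpha> \<subseteq> B"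
    by (auto simp: positive_roots_def roots_def)
  then obtain X where X: "X \<in> root_space n m \<alpha>" "X \<noteq> 0" using zero_root_space by blast
  then obtain c d where cd: "X c d \<noteq> 0" by (auto simp: fun_eq_iff)
  have eq: "\<alpha> = wt c - wt d" by (rule root_space_support(3)[OF \<alpha>(1) X(1) cd])
  then have "c \<noteq> d" using \<alpha>(2) by auto
  obtain H Y where HY: "X = H + (\<Sum>\<beta>\<in>P. Y \<beta>)" "H \<in> cartan n m" "\<forall>\<beta>\<in>P. Y \<beta> \<in> root_space n m \<beta>"
    using X(1) \<alpha>(4) unfolding B by blast
  have "X c d = H c d + (\<Sum>\<beta>\<in>P. Y \<beta> c d)" unfolding HY(1) plus_fun_apply sum_matrix_apply ..
  moreover have "H c d = 0" using HY(2) \<open>c \<noteq> d\<close> by (simp add: cartan_def)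
  ultimately have "(\<Sum>\<beta>\<in>P. Y \<beta> c d) \<noteq> 0" using cd by simp
  then obtain \<beta> where \<beta>: "\<beta> \<in> P" "Y \<beta> c d \<noteq> 0" by (meson sum.neutral)
  have "\<beta> \<in> weights n m" using \<beta> P by (auto simp: roots_def)
  then have "\<beta> = \<alpha>" using root_space_support(3)[of \<beta> n m "Y \<beta>" c d] HY(3) \<beta> eq by auto
  then show "\<alpha> \<in> P" using \<beta> by simp
next
  fix \<alpha> assume \<alpha>: "\<alpha> \<in> P"
  have "X \<in> B" if X: "X \<in> root_space n m \<alpha>" for X
  proof -
    have fin: "finite P" using finite_subset[OF P finite_roots] .
    have "(\<Sum>\<beta>\<in>P. if \<beta> = \<alpha> then X else 0) = X" using fin \<alpha> by simp
    then have "X = 0 + (\<Sum>\<beta>\<in>P. if \<beta> = \<alpha> then X else 0)" by simp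
    moreover have "0 \<in> cartan n m" by (simp add: cartan_def)
    moreover have "\<forall>\<beta>\<in>P. (if \<beta> = \<alpha> then X else 0) \<in> root_space n m \<beta>"
      using X zero_root_space by simp
    ultimately show ?thesis unfolding B by blast
  qed
  then show "\<alpha> \<in> positive_roots n m B" using \<alpha> P by (auto simp: positive_roots_def)
qed

text \<open>The final \<open>Zero\<close> expresses that g is positive on L. The head of L then
  exceeds the absolute value of g on everything later, exactly as its height does, so g and the
  height compare labels alike.\<close>

lemma height_order:
  fixes g :: "axis \<Rightarrow> real"
  assumes "Zero \<notin> set L" "sorted_wrt (\<lambda>a b. lval g b < lval g a) (L @ [Zero])"
    "c \<in> spread L" "d \<in> spread L" "lval (height L) d < lval (height L) c"
  shows "lval g d < lval g c"
  using assms
proof (induction L)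
  case Nil
  then show ?case by (simp add: spread_def)
next
  case (Cons a L)
  have a: "a \<noteq> Zero" and s: "sorted_wrt (\<lambda>a b. lval g b < lval g a) (L @ [Zero])"
    and less: "\<And>b. b \<in> set L \<Longrightarrow> lval g b < lval g a" and pos: "0 < lval g a"
    using Cons.prems by auto
  have "\<bar>lval g b\<bar> < lval g a" if "b \<in> set L" for b
  proof -
    have "0 < lval g b" using s that by (auto simp: sorted_wrt_append)
    then show ?thesis using less[OF that] by simp
  qed
  then have small: "\<bar>lval g e\<bar> < lval g a" if "e \<in> spread L" for e
    using that pos by (auto simp: spread_def)
  have IH: "lval g d < lval g c" if "c \<in> spread L" "d \<in> spread L" "lval (height L) d < lval (height L) c"
    using Cons.IH Cons.prems s that by auto
  show ?case
    using Cons.prems(3-5) IH small[of c] small[of d] pos height_bound[of L c] height_bound[of L d]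
    unfolding height_Cons[OF a] spread_Cons by (auto split: if_splits)
qed

text \<open>The regular Cartan element defining the positive system gives a real function g on the
  labels. Positivity of the simple roots makes g decrease along L and stay positive, so g induces
  the order of heights. The condition \<open>rv c d \<noteq> 0\<close> removes twice an epsilon,
  which is not a root.\<close>

lemma positive_roots_ordering:
  assumes B: "borel_subalgebra n m B" and L: "ordering n m L"
    and simple: "\<And>k. Suc k < length L \<Longrightarrow> wt (L ! k) - wt (L ! Suc k) \<in> simple_roots n m B"
      "L \<noteq> [] \<Longrightarrow> wt (last L) \<in> simple_roots n m B"
  shows "\<And>c d. c \<in> labels n m \<Longrightarrow> d \<in> labels n m \<Longrightarrow> rv c d \<noteq> 0 \<Longrightarrow>
      lval (height L) d < lval (height L) c \<Longrightarrow> wt c - wt d \<in> positive_roots n m B"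
    and "\<And>\<alpha> X c d. \<alpha> \<in> positive_roots n m B \<Longrightarrow> X \<in> root_space n m \<alpha> \<Longrightarrow> X c d \<noteq> 0 \<Longrightarrow>
      lval (height L) d < lval (height L) c"
proof -
  obtain P x where x: "x \<in> cartan n m" and P: "P = {\<alpha> \<in> roots n m. Re (weight_eval n m \<alpha> x) > 0}"
    and BP: "B = {H + (\<Sum>\<alpha>\<in>P. Y \<alpha>) | H Y. H \<in> cartan n m \<and> (\<forall>\<alpha>\<in>P. Y \<alpha> \<in> root_space n m \<alpha>)}"
    using B unfolding borel_subalgebra_def positive_system_def by blast
  have PB: "positive_roots n m B = P"
    by (rule positive_roots_borel[OF _ BP]) (auto simp: P)
  define g where "g y = Re (x (Pos y) (Pos y))" for y
  have g: "Re (x c c) = lval g c" for c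
    using cartan_bar[OF x, of "Pos _"] cartan_bar[OF x, of Zero] by (cases c) (auto simp: g_def)
  have ev: "Re (weight_eval n m (wt c - wt d) x) = lval g c - lval g d"
    if "c \<in> labels n m" "d \<in> labels n m" for c d
    unfolding weight_eval_diff weight_eval_wt[OF x that(1)] weight_eval_wt[OF x that(2)] by (simp add: g)
  have lab: "labels n m = spread L" by (rule labels_ordering[OF L])
  have simpleP: "simple_roots n m B \<subseteq> P" using PB by (auto simp: simple_roots_def)
  \<comment> \<open>Since wt Zero = 0, appending \<open>Zero\<close> makes the last simple root one
    more difference of neighbours.\<close>
  have "lval g ((L @ [Zero]) ! Suc i) < lval g ((L @ [Zero]) ! i)" if "Suc i < length (L @ [Zero])" for i
  proof -
    have mem: "(L @ [Zero]) ! j \<in> labels n m" if "j < length (L @ [Zero])" for j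
      using nth_mem[OF that] by (auto simp: lab spread_def)
    have w0: "wt Zero = 0" by (auto simp: wt_def)
    have "wt ((L @ [Zero]) ! i) - wt ((L @ [Zero]) ! Suc i) \<in> P"
    proof (cases "Suc i < length L")
      case True
      then show ?thesis using simple(1)[OF True] simpleP by (auto simp: nth_append)
    next
      case False
      then have "L \<noteq> []" "i = length L - 1" "Suc i = length L" using that by auto
      then show ?thesis using simple(2) simpleP by (auto simp: nth_append last_conv_nth w0)
    qed
    then have "Re (weight_eval n m (wt ((L @ [Zero]) ! i) - wt ((L @ [Zero]) ! Suc i)) x) > 0"
      by (simp add: P)
    then show ?thesis using ev[OF mem mem, of i "Suc i"] that by simp
  qed
  then have sorted: "sorted_wrt (\<lambda>a b. lval g b < lval g a) (L @ [Zero])"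
    by (subst sorted_wrt_iff_nth_Suc_transp) (auto simp: transp_def)
  have ord: "lval g d < lval g c" if "c \<in> labels n m" "d \<in> labels n m" "lval (height L) d < lval (height L) c"
    for c d
    using height_order[OF _ sorted] that L unfolding lab ordering_def by blast
  show "wt c - wt d \<in> positive_roots n m B"
    if cd: "c \<in> labels n m" "d \<in> labels n m" and nz: "rv c d \<noteq> 0" and less: "lval (height L) d < lval (height L) c"
    for c d
  proof -
    have "Re (weight_eval n m (wt c - wt d) x) > 0"
      using ord[OF cd less] ev[OF cd] by simp
    moreover from this have "wt c - wt d \<noteq> 0" by (auto simp: weight_eval_def)
    moreover have "wt c - wt d \<in> weights n m"
      using wt_weights[OF cd(1)] wt_weights[OF cd(2)] by (simp add: weights_def)
    moreover have "root_space n m (wt c - wt d) \<noteq> {0}" using root_space_rv[OF cd] nz by blast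
    ultimately show ?thesis unfolding PB P roots_def by blast
  qed
  show "lval (height L) d < lval (height L) c"
    if \<alpha>: "\<alpha> \<in> positive_roots n m B" and X: "X \<in> root_space n m \<alpha>" "X c d \<noteq> 0" for \<alpha> X c d
  proof -
    have r: "\<alpha> \<in> roots n m" "Re (weight_eval n m \<alpha> x) > 0" using \<alpha> PB P by auto
    then have w: "\<alpha> \<in> weights n m" by (simp add: roots_def)
    note s = root_space_support[OF w X]
    have "lval g d < lval g c" using r(2) ev[OF s(1,2)] s(3) by simp
    moreover from this have "c \<noteq> d" by auto
    then have "lval (height L) c \<noteq> lval (height L) d"
      using inj_onD[OF inj_on_height_ordering[OF L] _ s(1,2)] by blast
    ultimately show ?thesis using ord[OF s(2,1)] by linarith
  qed
qed

text \<open>Translates the condition on a Borel subalgebra into one on a list of labels; the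
  transport of weights takes place entirely on such lists.\<close>

lemma (in osp_module) highest_weight_iff:
  assumes "borel_subalgebra n m B" "ordering n m L"
    "\<And>k. Suc k < length L \<Longrightarrow> wt (L ! k) - wt (L ! Suc k) \<in> simple_roots n m B"
    "L \<noteq> [] \<Longrightarrow> wt (last L) \<in> simple_roots n m B"
  shows "highest_weight scale n m act B \<mu> \<longleftrightarrow>
    \<mu> \<in> weights n m \<and> (\<exists>v. v \<noteq> 0 \<and> weight_vector \<mu> v \<and> singular (height L) v)"
proof -
  have "(\<forall>\<alpha>\<in>positive_roots n m B. \<forall>X\<in>root_space n m \<alpha>. act X v = 0) \<longleftrightarrow> singular (height L) v" for v
  proof
    assume *: "\<forall>\<alpha>\<in>positive_roots n m B. \<forall>X\<in>root_space n m \<alpha>. act X v = 0"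
    show "singular (height L) v"
      unfolding singular_def
    proof (intro ballI impI)
      fix c d assume cd: "c \<in> labels n m" "d \<in> labels n m" "lval (height L) d < lval (height L) c"
      show "act (rv c d) v = 0"
      proof (cases "rv c d = 0")
        case False
        then show ?thesis
          using * positive_roots_ordering(1)[OF assms cd(1,2) False cd(3)] root_space_rv[OF cd(1,2)] by blast
      qed simp
    qed
  next
    assume *: "singular (height L) v"
    show "\<forall>\<alpha>\<in>positive_roots n m B. \<forall>X\<in>root_space n m \<alpha>. act X v = 0"
    proof (intro ballI)
      fix \<alpha> X assume \<alpha>: "\<alpha> \<in> positive_roots n m B" "X \<in> root_space n m \<alpha>"
      have "X \<in> osp n m" using \<alpha>(2) by (simp add: root_space_def)
      then have "act X v \<in> {0}"
      proof (rule act_mem[OF _ subspace_single_0])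
        fix c d assume "c \<in> labels n m" "d \<in> labels n m" "X c d \<noteq> 0"
        then show "act (rv c d) v \<in> {0}"
          using * positive_roots_ordering(2)[OF assms \<alpha>] by (simp add: singular_def)
      qed
      then show "act X v = 0" by simp
    qed
  qed
  then show ?thesis unfolding highest_weight_def weight_vector_def by simp
qed

section \<open>Transport of the highest weight through exchanges and sign changes\<close>

context irreducible_osp_module
begin

text \<open>The invariant of the chain. It includes \<open>ordering\<close>, so intermediate lists
  need no separate check.\<close>

definition extremal :: "(nat \<Rightarrow> nat) \<Rightarrow> label list \<Rightarrow> bool" where
  "extremal l L \<longleftrightarrow> ordering n m L \<and>
     (\<exists>v. v \<noteq> 0 \<and> homogeneous v \<and> weight_vector (list_weight l 0 0 L) v \<and> singular (height L) v)"

lemma swap_reflection: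
  assumes L: "ordering n m (xs @ p # b # ys)"
    and v: "v \<noteq> 0" "homogeneous v" "weight_vector \<mu> v" "singular (height (xs @ p # b # ys)) v"
    and s: "s = (-1) ^ ((parity p + parity b) mod 2)"
    and c: "c 0 = 0"
      "\<And>k. c (Suc k) = s * c k + (lval \<mu> p - s * lval \<mu> b - of_nat k * (1 + s))"
      "c (Suc r) = 0" "\<And>k. 1 \<le> k \<Longrightarrow> k \<le> r \<Longrightarrow> c k \<noteq> 0"
  shows "\<exists>w. w \<noteq> 0 \<and> homogeneous w \<and>
    weight_vector (\<mu> + weight_scale (of_nat r) (wt b - wt p)) w \<and> singular (height (xs @ b # p # ys)) w"
proof -
  let ?L = "xs @ p # b # ys" and ?L' = "xs @ b # p # ys"
  define k where "k = int (length ys)"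
  define y where "y = height ?L"
  define y' where "y' = height ?L'"
  \<comment> \<open>Adding the two height functions produces the wall: p and b have heights k + 2
    and k + 1 in one ordering and the reverse in the other, so both receive 2 k + 3.\<close>
  define y0 where "y0 = (\<lambda>x. y x + y' x)"
  have y0: "lval y0 c = lval y c + lval y' c" for c
    by (cases c) (auto simp: y0_def)
  have Z: "Zero \<notin> set ?L" and dist: "distinct (map axis_of ?L)"
    using L by (auto simp: ordering_def)
  have y': "lval y' c = (if lval y c = k + 2 then k + 1 else if lval y c = k + 1 then k + 2
      else if lval y c = - (k + 1) then - (k + 2) else if lval y c = - (k + 2) then - (k + 1) else lval y c)" for c
    using height_swap[OF Z dist, of c] by (simp add: y_def y'_def k_def Let_def)
  have k: "0 \<le> k" by (simp add: k_def)
  have yp: "lval y p = k + 2" using height_middle[OF Z dist] by (simp add: y_def k_def)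
  have yb: "lval y b = k + 1"
    using height_middle[of "xs @ [p]" b ys] Z dist by (simp add: y_def k_def)
  have lab: "p \<in> labels n m" "b \<in> labels n m"
    using labels_ordering[OF L] by (auto simp: spread_def)
  have inj: "inj_on (lval y) (labels n m)" unfolding y_def by (rule inj_on_height_ordering[OF L])
  have eqs: "i = p" if "i \<in> labels n m" "lval y i = k + 2" for i
    using inj_onD[OF inj _ that(1) lab(1)] that yp by simp
  have eqs': "i = b" if "i \<in> labels n m" "lval y i = k + 1" for i
    using inj_onD[OF inj _ that(1) lab(2)] that yb by simp
  have eqs2: "i = bar p" if "i \<in> labels n m" "lval y i = - (k + 2)" for i
    using inj_onD[OF inj _ that(1), of "bar p"] lab that yp by simp
  have eqs2': "i = bar b" if "i \<in> labels n m" "lval y i = - (k + 1)" for i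
    using inj_onD[OF inj _ that(1), of "bar b"] lab that yb by simp
  show ?thesis
    unfolding y'_def[symmetric]
  proof (rule singular_reflection[of v \<mu> y p b y0 y' s c r])
    show "v \<noteq> 0" "homogeneous v" "weight_vector \<mu> v" "singular y v" using v by (simp_all add: y_def)
    show "inj_on (lval y) (labels n m)" by (rule inj)
    show "p \<in> labels n m" "b \<in> labels n m" by (rule lab)+
    show "p \<noteq> Zero" using Z by auto
    have "b \<noteq> Zero" using Z by auto
    then show "c (Suc k) = s * c k + (lval \<mu> p - s * lval \<mu> b - of_nat k * (if b = Zero then 1 else 1 + s))" for k
      using c(2) by simp
    show "p \<noteq> b" "p \<noteq> bar b" using dist by auto
    show "lval y0 p = lval y0 b" using y'[of p] y'[of b] yp yb y0 by simp
    fix i j assume ij: "i \<in> labels n m" "j \<in> labels n m"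
    show "lval y j < lval y i" if "lval y0 j < lval y0 i"
      using that y'[of i] y'[of j] k unfolding y0 by (auto split: if_splits)
    show "lval y0 j < lval y0 i \<or> (i = p \<and> j = b) \<or> (i = bar b \<and> j = bar p) \<or> (b = Zero \<and> i = p \<and> j = bar p)"
      if less: "lval y j < lval y i"
    proof -
      have "lval y0 j < lval y0 i \<or> (lval y i = k + 2 \<and> lval y j = k + 1) \<or>
          (lval y i = - (k + 1) \<and> lval y j = - (k + 2))"
        using less y'[of i] y'[of j] k unfolding y0 by (auto split: if_splits)
      then show ?thesis
        using eqs[OF ij(1)] eqs[OF ij(2)] eqs'[OF ij(1)] eqs'[OF ij(2)]
          eqs2[OF ij(1)] eqs2[OF ij(2)] eqs2'[OF ij(1)] eqs2'[OF ij(2)] by satx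
    qed
    show "lval y0 j < lval y0 i \<or> (i = b \<and> j = p) \<or> (i = bar p \<and> j = bar b) \<or> (b = Zero \<and> i = bar p \<and> j = p)"
      if less: "lval y' j < lval y' i"
    proof -
      have "lval y0 j < lval y0 i \<or> (lval y i = k + 1 \<and> lval y j = k + 2) \<or>
          (lval y i = - (k + 2) \<and> lval y j = - (k + 1))"
        using less y'[of i] y'[of j] k unfolding y0 by (auto split: if_splits)
      then show ?thesis
        using eqs[OF ij(1)] eqs[OF ij(2)] eqs'[OF ij(1)] eqs'[OF ij(2)]
          eqs2[OF ij(1)] eqs2[OF ij(2)] eqs2'[OF ij(1)] eqs2'[OF ij(2)] by satx
    qed
  qed (use s c in auto)
qed

lemma flip_reflection:
  assumes L: "ordering n m (xs @ [p])"
    and v: "v \<noteq> 0" "homogeneous v" "weight_vector \<mu> v" "singular (height (xs @ [p])) v"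
    and s: "s = (-1) ^ ((parity p + 1) mod 2)"
    and c: "c 0 = 0" "\<And>k. c (Suc k) = s * c k + (lval \<mu> p - of_nat k)"
      "c (Suc r) = 0" "\<And>k. 1 \<le> k \<Longrightarrow> k \<le> r \<Longrightarrow> c k \<noteq> 0"
  shows "\<exists>w. w \<noteq> 0 \<and> homogeneous w \<and>
    weight_vector (\<mu> + weight_scale (of_nat r) (wt Zero - wt p)) w \<and> singular (height (xs @ [bar p])) w"
proof -
  let ?L = "xs @ [p]" and ?L' = "xs @ [bar p]"
  define y where "y = height ?L"
  define y' where "y' = height ?L'"
  \<comment> \<open>Here p has heights 1 and -1, so on the wall it meets
    \<open>Zero\<close>.\<close>
  define y0 where "y0 = (\<lambda>x. y x + y' x)"
  have y0: "lval y0 c = lval y c + lval y' c" for c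
    by (cases c) (auto simp: y0_def)
  have Z: "Zero \<notin> set ?L" and dist: "distinct (map axis_of ?L)"
    using L by (auto simp: ordering_def)
  have y': "lval y' c = (if lval y c = 1 then - 1 else if lval y c = - 1 then 1 else lval y c)" for c
    using height_flip[OF Z dist, of c] by (simp add: y_def y'_def Let_def)
  have yp: "lval y p = 1" using height_middle[of xs p "[]"] Z dist by (simp add: y_def)
  have lab: "p \<in> labels n m"
    using labels_ordering[OF L] by (auto simp: spread_def)
  have inj: "inj_on (lval y) (labels n m)" unfolding y_def by (rule inj_on_height_ordering[OF L])
  have eqs: "i = p" if "i \<in> labels n m" "lval y i = 1" for i
    using inj_onD[OF inj _ that(1) lab] that yp by simp
  have eqs': "i = Zero" if "i \<in> labels n m" "lval y i = 0" for i
    using inj_onD[OF inj _ that(1), of Zero] that by simp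
  have eqs2: "i = bar p" if "i \<in> labels n m" "lval y i = - 1" for i
    using inj_onD[OF inj _ that(1), of "bar p"] lab that yp by simp
  show ?thesis
    unfolding y'_def[symmetric]
  proof (rule singular_reflection[of v \<mu> y p Zero y0 y' s c r])
    show "v \<noteq> 0" "homogeneous v" "weight_vector \<mu> v" "singular y v" using v by (simp_all add: y_def)
    show "inj_on (lval y) (labels n m)" by (rule inj)
    show "p \<in> labels n m" "Zero \<in> labels n m" using lab by simp_all
    show "p \<noteq> Zero" "p \<noteq> Zero" "p \<noteq> bar Zero" using Z by auto
    show "c (Suc k) = s * c k +
        (lval \<mu> p - s * lval \<mu> Zero - of_nat k * (if Zero = Zero then 1 else 1 + s))" for k
      using c(2) by simp
    show "lval y0 p = lval y0 Zero" using y'[of p] yp y0 by simp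
    fix i j assume ij: "i \<in> labels n m" "j \<in> labels n m"
    show "lval y j < lval y i" if "lval y0 j < lval y0 i"
      using that y'[of i] y'[of j] unfolding y0 by (auto split: if_splits)
    show "lval y0 j < lval y0 i \<or> (i = p \<and> j = Zero) \<or> (i = bar Zero \<and> j = bar p) \<or>
        (Zero = Zero \<and> i = p \<and> j = bar p)"
      if less: "lval y j < lval y i"
    proof -
      have "lval y0 j < lval y0 i \<or> (lval y i = 1 \<and> lval y j = 0) \<or>
          (lval y i = 0 \<and> lval y j = - 1) \<or> (lval y i = 1 \<and> lval y j = - 1)"
        using less y'[of i] y'[of j] unfolding y0 by (auto split: if_splits)
      then show ?thesis
        using eqs[OF ij(1)] eqs[OF ij(2)] eqs'[OF ij(1)] eqs'[OF ij(2)]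
          eqs2[OF ij(1)] eqs2[OF ij(2)] by simp blast?
    qed
    show "lval y0 j < lval y0 i \<or> (i = Zero \<and> j = p) \<or> (i = bar p \<and> j = bar Zero) \<or>
        (Zero = Zero \<and> i = bar p \<and> j = p)"
      if less: "lval y' j < lval y' i"
    proof -
      have "lval y0 j < lval y0 i \<or> (lval y i = 0 \<and> lval y j = 1) \<or>
          (lval y i = - 1 \<and> lval y j = 0) \<or> (lval y i = - 1 \<and> lval y j = 1)"
        using less y'[of i] y'[of j] unfolding y0 by (auto split: if_splits)
      then show ?thesis
        using eqs[OF ij(1)] eqs[OF ij(2)] eqs'[OF ij(1)] eqs'[OF ij(2)]
          eqs2[OF ij(1)] eqs2[OF ij(2)] by simp blast?
    qed
  qed (use s c in auto)
qed

text \<open>The numbers of entries before xs and ys do not change, so the two weights differ only at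
  p and b. The reflection moves r units from p to b, and it remains to exhibit r and a solution of
  the recursion.\<close>

lemma extremal_swap:
  assumes l: "partition l" and "extremal l (xs @ p # b # ys)"
  shows "extremal l (xs @ b # p # ys)"
proof -
  let ?L = "xs @ p # b # ys" and ?L' = "xs @ b # p # ys"
  obtain v where L: "ordering n m ?L"
    and v: "v \<noteq> 0" "homogeneous v" "weight_vector (list_weight l 0 0 ?L) v" "singular (height ?L) v"
    using assms by (auto simp: extremal_def)
  define d where "d = parity_count 0 xs"
  define e where "e = parity_count 1 xs"
  define A where "A = frob_coeff l d e p"
  define B where "B = frob_coeff l (d + parity_count 0 [p]) (e + parity_count 1 [p]) b"
  define A' where "A' = frob_coeff l (d + parity_count 0 [b]) (e + parity_count 1 [b]) p"
  define B' where "B' = frob_coeff l d e b"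
  define R where "R = list_weight l (d + parity_count 0 [p, b]) (e + parity_count 1 [p, b]) ys"
  define \<mu> where "\<mu> = list_weight l 0 0 ?L"
  have pc: "parity_count q [a, a'] = parity_count q [a] + parity_count q [a']" for q a a'
    by (simp add: parity_count_def)
  have mu: "\<mu> = list_weight l 0 0 xs + (weight_scale (of_int A) (wt p) + (weight_scale (of_int B) (wt b) + R))"
    by (simp add: \<mu>_def list_weight_append A_def B_def R_def d_def e_def pc add.assoc del: One_nat_def)
  have mu': "list_weight l 0 0 ?L' =
      list_weight l 0 0 xs + (weight_scale (of_int B') (wt b) + (weight_scale (of_int A') (wt p) + R))"
    by (simp add: list_weight_append A'_def B'_def R_def d_def e_def pc add.assoc add.commute add.left_commute
        del: One_nat_def)
  have Z: "p \<noteq> Zero" "b \<noteq> Zero" "Zero \<notin> set xs" "Zero \<notin> set ys"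
    and D: "axis_of p \<noteq> axis_of b" "axis_of b \<noteq> axis_of p" "axis_of p \<notin> axis_of ` set xs" "axis_of p \<notin> axis_of ` set ys"
      "axis_of b \<notin> axis_of ` set xs" "axis_of b \<notin> axis_of ` set ys"
    using L by (auto simp: ordering_def)
  have Ap: "lval \<mu> p = of_int A" and Bb: "lval \<mu> b = of_int B"
    unfolding mu lval_add lval_weight_scale R_def
    using Z D by (simp_all add: lval_list_weight_outside lval_wt_self lval_wt_other del: One_nat_def)
  define s :: complex where "s = (-1) ^ ((parity p + parity b) mod 2)"
  have L': "ordering n m ?L'" using L by (auto simp: ordering_def)
  have finish: "extremal l ?L'" if "A - int r = A'" "B + int r = B'"
    and c: "c 0 = 0" "\<And>k. c (Suc k) = s * c k + (of_int A - s * of_int B - of_nat k * (1 + s))"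
      "c (Suc r) = 0" "\<And>k. 1 \<le> k \<Longrightarrow> k \<le> r \<Longrightarrow> c k \<noteq> 0" for r and c :: "nat \<Rightarrow> complex"
  proof -
    have "\<mu> + weight_scale (of_nat r) (wt b - wt p) = list_weight l 0 0 ?L'"
      unfolding mu mu' that(1,2)[symmetric]
      by (auto simp: weight_scale_def fun_eq_iff algebra_simps)
    moreover have "\<exists>w. w \<noteq> 0 \<and> homogeneous w \<and>
        weight_vector (\<mu> + weight_scale (of_nat r) (wt b - wt p)) w \<and> singular (height ?L') w"
      by (rule swap_reflection[OF L v[folded \<mu>_def] s_def, of c]) (use c Ap Bb in auto)
    ultimately show ?thesis using L' unfolding extremal_def by auto
  qed
  have pb: "parity p = 0 \<or> parity p = 1" "parity b = 0 \<or> parity b = 1" by (rule parity_cases)+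
  show ?thesis
  proof (cases "parity p = parity b")
    case True
    then have "parity p + parity b = 2 * parity b" by simp
    then have s: "s = 1" by (simp add: s_def)
    have "B \<le> A" "A' = B" "B' = A"
      using True pb partition_antimono[OF l, of "Suc d" "Suc (Suc d)"]
        conjugate_antimono[OF l, of "Suc e" "Suc (Suc e)"]
      by (auto simp: A_def B_def A'_def B'_def frob_coeff_def parity_count_def)
    \<comment> \<open>For s = 1 the increments of \<open>c\<close> are A - B - 2 k, which gives the
      sl(2) coefficients k (r + 1 - k). Rows and columns of a partition decrease, so A - B is not
      negative.\<close>
    define r where "r = nat (A - B)"
    have r: "int r = A - B" using \<open>B \<le> A\<close> by (simp add: r_def)
    have "of_nat r = (of_int A - of_int B :: complex)"
      using r by (metis of_int_diff of_int_of_nat_eq)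
    moreover have "of_nat k * (of_nat r + 1 - of_nat k) \<noteq> (0 :: complex)" if "1 \<le> k" "k \<le> r" for k
    proof -
      have "of_nat (r + 1) \<noteq> (of_nat k :: complex)" using that by (simp only: of_nat_eq_iff)
      then show ?thesis using that by (simp add: add.commute)
    qed
    ultimately show ?thesis
      using r \<open>A' = B\<close> \<open>B' = A\<close>
      by (intro finish[of r "\<lambda>k. of_nat k * (of_nat r + 1 - of_nat k)"]) (simp_all add: s algebra_simps)
  next
    case False
    then have s: "s = -1" using pb by (auto simp: s_def)
    \<comment> \<open>The box in row d + 1 and column e + 1. It is counted by whichever of the two
      entries comes first, so exchanging them moves one unit exactly when the box is
      present.\<close>
    define box where "box \<longleftrightarrow> Suc e \<le> l (Suc d)"
    have box': "box \<longleftrightarrow> Suc d \<le> conjugate l (Suc e)"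
      using le_conjugate_iff[OF l, of "Suc d" "Suc e"] by (simp add: box_def)
    have AB: "if box then A' = A - 1 \<and> B' = B + 1 \<and> 0 < A + B else A = 0 \<and> B = 0 \<and> A' = 0 \<and> B' = 0"
      using False pb box'
      by (auto simp: A_def B_def A'_def B'_def frob_coeff_def parity_count_def box_def)
    show ?thesis
    proof (cases box)
      case True
      \<comment> \<open>For s = -1 the factor 1 + s vanishes and the next coefficient is A + B minus
        the current one. The sequence alternates between 0 and A + B, so r = 1.\<close>
      then have "of_int (A + B) \<noteq> (0 :: complex)" using AB by (simp only: of_int_eq_0_iff) auto
      then show ?thesis
        using True AB
        by (intro finish[of 1 "\<lambda>k. if odd k then of_int (A + B) else 0"]) (auto simp: s le_Suc_eq)
    next
      case False
      then show ?thesis using AB by (intro finish[of 0 "\<lambda>k. 0"]) (auto simp: s)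
    qed
  qed
qed

text \<open>The coefficient at p has to pass from r to -r while each lowering subtracts wt p once;
  hence 2 r lowerings.\<close>

lemma extremal_flip:
  assumes "extremal l (xs @ [p])"
  shows "extremal l (xs @ [bar p])"
proof -
  let ?L = "xs @ [p]" and ?L' = "xs @ [bar p]"
  obtain v where L: "ordering n m ?L"
    and v: "v \<noteq> 0" "homogeneous v" "weight_vector (list_weight l 0 0 ?L) v" "singular (height ?L) v"
    using assms by (auto simp: extremal_def)
  define A where "A = frob_coeff l (parity_count 0 xs) (parity_count 1 xs) p"
  define r where "r = nat A"
  have A: "A = int r" by (auto simp: r_def A_def frob_coeff_def)
  define \<mu> where "\<mu> = list_weight l 0 0 ?L"
  have mu: "\<mu> = list_weight l 0 0 xs + weight_scale (of_nat r) (wt p)"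
    using A by (simp add: \<mu>_def list_weight_append A_def del: One_nat_def)
  have "frob_coeff l (parity_count 0 xs) (parity_count 1 xs) (bar p) = A"
    by (simp add: A_def frob_coeff_def)
  then have mu': "list_weight l 0 0 ?L' = list_weight l 0 0 xs + weight_scale (of_nat r) (wt (bar p))"
    using A by (simp add: list_weight_append del: One_nat_def)
  have Z: "p \<noteq> Zero" "Zero \<notin> set xs" and D: "axis_of p \<notin> axis_of ` set xs"
    using L by (auto simp: ordering_def)
  have Ap: "lval \<mu> p = of_nat r"
    unfolding mu lval_add lval_weight_scale
    using Z D by (simp add: lval_list_weight_outside lval_wt_self)
  define s :: complex where "s = (-1) ^ ((parity p + 1) mod 2)"
  \<comment> \<open>Solutions of c(k + 1) = s c(k) + r - k. For s = 1 the increments sum to a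
    quadratic polynomial; for s = -1 the even and the odd k follow two linear sequences. In both
    cases the first zero after k = 0 is k = 2 r + 1.\<close>
  define c :: "nat \<Rightarrow> complex" where
    "c k = (if parity p = 1 then of_nat k * (2 * of_nat r + 1 - of_nat k) / 2
       else if even k then - of_nat k / 2 else of_nat r - (of_nat k - 1) / 2)" for k
  have L': "ordering n m ?L'" using L by (auto simp: ordering_def)
  have s: "s = (if parity p = 1 then 1 else -1)"
    using parity_cases[of p] by (auto simp: s_def)
  have "\<exists>w. w \<noteq> 0 \<and> homogeneous w \<and>
    weight_vector (\<mu> + weight_scale (of_nat (2 * r)) (wt Zero - wt p)) w \<and> singular (height ?L') w"
  proof (rule flip_reflection[OF L v[folded \<mu>_def] s_def, of c])
    show "c 0 = 0" by (simp add: c_def)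
    show "c (Suc k) = s * c k + (lval \<mu> p - of_nat k)" for k
      unfolding Ap s by (auto simp: c_def field_simps)
    show "c (Suc (2 * r)) = 0" by (auto simp: c_def)
    fix k assume k: "1 \<le> k" "k \<le> 2 * r"
    have "of_nat (2 * r + 1) \<noteq> (of_nat k :: complex)" using k by (simp only: of_nat_eq_iff)
    then have "2 * of_nat r + 1 - of_nat k \<noteq> (0 :: complex)" "of_nat k \<noteq> (0 :: complex)"
      using k by (simp_all add: add.commute)
    moreover have "of_nat r - (of_nat k - 1) / 2 = (2 * of_nat r + 1 - of_nat k) / (2 :: complex)"
      by (simp add: field_simps)
    ultimately show "c k \<noteq> 0" unfolding c_def by (simp only:) simp
  qed
  moreover have "\<mu> + weight_scale (of_nat (2 * r)) (wt Zero - wt p) = list_weight l 0 0 ?L'"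
  proof -
    have "wt Zero = 0" by (auto simp: wt_def)
    then show ?thesis
      unfolding mu mu' wt_bar by (auto simp: weight_scale_def fun_eq_iff algebra_simps)
  qed
  ultimately show ?thesis using L' unfolding extremal_def by auto
qed

lemma extremal_independent:
  assumes "partition l" "ordering n m K" "ordering n m L" "extremal l K"
  shows "extremal l L"
proof (rule orderings_connected[where P = "extremal l", OF _ _ assms(2-4)])
  show "extremal l (xs @ b # a # ys)" if "extremal l (xs @ a # b # ys)" for xs a b ys
    by (rule extremal_swap[OF assms(1) that])
  show "extremal l (xs @ [bar a])" if "extremal l (xs @ [a])" for xs a
    by (rule extremal_flip[OF that])
qed

text \<open>\<open>singular_unique\<close> determines the coefficients on the axes; membership in
  \<open>weights\<close> makes the others zero on both sides.\<close>

lemma highest_weight_extremal: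
  assumes B: "borel_subalgebra n m B" "ordering n m L"
    "\<And>k. Suc k < length L \<Longrightarrow> wt (L ! k) - wt (L ! Suc k) \<in> simple_roots n m B"
    "L \<noteq> [] \<Longrightarrow> wt (last L) \<in> simple_roots n m B"
    and ex: "extremal l L" and weights: "list_weight l 0 0 L \<in> weights n m"
  shows "highest_weight scale n m act B \<mu> \<longleftrightarrow> \<mu> = list_weight l 0 0 L"
proof -
  obtain w where w: "w \<noteq> 0" "homogeneous w" "weight_vector (list_weight l 0 0 L) w" "singular (height L) w"
    using ex unfolding extremal_def by (elim exE conjE)
  have iff: "highest_weight scale n m act B \<mu> \<longleftrightarrow>
    \<mu> \<in> weights n m \<and> (\<exists>v. v \<noteq> 0 \<and> weight_vector \<mu> v \<and> singular (height L) v)" for \<mu>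
    by (rule highest_weight_iff[OF B])
  show ?thesis
  proof
    assume hw: "highest_weight scale n m act B \<mu>"
    have \<mu>: "\<mu> \<in> weights n m" and "\<exists>v. v \<noteq> 0 \<and> weight_vector \<mu> v \<and> singular (height L) v"
      using hw iff by simp_all
    then obtain v where v: "v \<noteq> 0" "weight_vector \<mu> v" "singular (height L) v"
      by (elim exE conjE)
    obtain v' where v': "v' \<noteq> 0" "homogeneous v'" "weight_vector \<mu> v'" "singular (height L) v'"
      using homogeneous_singular[OF v(1,3,2)] by (elim exE conjE)
    show "\<mu> = list_weight l 0 0 L"
    proof
      fix x
      show "\<mu> x = list_weight l 0 0 L x"
      proof (cases "x \<in> axes n m")
        case True
        then show ?thesis by (rule singular_unique[OF v' w inj_on_height_ordering[OF B(2)]])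
      next
        case False
        then show ?thesis using \<mu> weights by (simp add: weights_def)
      qed
    qed
  next
    assume "\<mu> = list_weight l 0 0 L"
    then show "highest_weight scale n m act B \<mu>"
      using w weights iff by blast
  qed
qed

end

section \<open>From the sequence of a Borel subalgebra to a list of labels\<close>

lemma parity_count_map:
  "parity_count q (map g [1..<k]) = card {j \<in> {1..<k}. parity (g j) = q}"
proof -
  have "parity_count q (map g [1..<k]) = length (filter (\<lambda>j. parity (g j) = q) [1..<k])"
    by (simp add: parity_count_def filter_map o_def)
  also have "\<dots> = card ({j. parity (g j) = q} \<inter> set [1..<k])"
    by (rule distinct_length_filter) simp
  also have "{j. parity (g j) = q} \<inter> set [1..<k] = {j \<in> {1..<k}. parity (g j) = q}"
    by auto
  finally show ?thesis .
qed

lemma list_weight_map: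
  "list_weight l 0 0 (map g [1..<Suc N]) = (\<Sum>k = 1..N. weight_scale
     (of_int (frob_coeff l (parity_count 0 (map g [1..<k])) (parity_count 1 (map g [1..<k])) (g k))) (wt (g k)))"
proof (induction N)
  case (Suc N)
  have "[1..<Suc (Suc N)] = [1..<Suc N] @ [Suc N]" by simp
  then have "map g [1..<Suc (Suc N)] = map g [1..<Suc N] @ [g (Suc N)]" by simp
  then show ?case
    by (simp only: list_weight_append list_weight.simps Suc sum.cl_ivl_Suc) simp
qed simp

definition signed_label :: "int \<Rightarrow> axis \<Rightarrow> label" where
  "signed_label z x = (if z = 1 then Pos x else Neg x)"

lemma axis_of_signed_label [simp]: "axis_of (signed_label z x) = x"
  by (simp add: signed_label_def)

lemma signed_label_nonzero [simp]: "signed_label z x \<noteq> Zero"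
  by (simp add: signed_label_def)

lemma parity_signed_label [simp]:
  "parity (signed_label z (Del i)) = 0" "parity (signed_label z (Eps j)) = 1"
  by (simp_all add: signed_label_def)

lemma wt_signed_label:
  assumes "z \<in> {1, - 1}"
  shows "wt (signed_label z (Del i)) = weight_scale (of_int z) (delta i)"
    "wt (signed_label z (Eps i)) = weight_scale (of_int z) (eps i)"
  using assms by (auto simp: signed_label_def wt_def weight_scale_def delta_def eps_def fun_eq_iff)

text \<open>Splitting the sum over positions into the images of u and w turns the recursive weight
  into the block Frobenius weight.\<close>

lemma sequence_ordering:
  assumes u: "strict_mono_on {1..n} u" and w: "strict_mono_on {1..m} w"
    and disj: "u ` {1..n} \<inter> w ` {1..m} = {}" and cover: "u ` {1..n} \<union> w ` {1..m} = {1..m + n}"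
    and s: "s permutes {1..n}" and t: "t permutes {1..m}"
    and \<xi>: "\<forall>i\<in>{1..n}. \<xi> i \<in> {1, -1}" and \<eta>: "\<forall>j\<in>{1..m}. \<eta> j \<in> {1, -1}"
    and fu: "\<forall>i\<in>{1..n}. f (u i) = weight_scale (of_int (\<xi> i)) (delta (s i))"
    and fw: "\<forall>j\<in>{1..m}. f (w j) = weight_scale (of_int (\<eta> j)) (eps (t j))"
  shows "\<exists>L. ordering n m L \<and> length L = m + n \<and> (\<forall>k<m + n. wt (L ! k) = f (Suc k)) \<and>
    list_weight l 0 0 L = frob_weight n m u w s t \<xi> \<eta> l"
proof -
  \<comment> \<open>Distinct labels have distinct weights, and each entry of the sequence is the
    weight of one label, which g recovers.\<close>
  define g where "g k = inv wt (f k)" for k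
  have "inj wt" by (simp add: inj_def wt_inj)
  then have gI: "g k = a" if "f k = wt a" for k a
    using that by (simp add: g_def)
  have gu: "g (u i) = signed_label (\<xi> i) (Del (s i))" if "i \<in> {1..n}" for i
    using that fu \<xi> wt_signed_label(1) by (intro gI) simp
  have gw: "g (w j) = signed_label (\<eta> j) (Eps (t j))" if "j \<in> {1..m}" for j
    using that fw \<eta> wt_signed_label(2) by (intro gI) simp
  have cases: "(\<exists>i\<in>{1..n}. k = u i) \<or> (\<exists>j\<in>{1..m}. k = w j)" if "k \<in> {1..m + n}" for k
    using that cover by blast
  have range: "u i \<in> {1..m + n}" if "i \<in> {1..n}" for i
    using that cover by blast
  have range': "w j \<in> {1..m + n}" if "j \<in> {1..m}" for j
    using that cover by blast
  have u_inj: "inj_on u {1..n}" and w_inj: "inj_on w {1..m}"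
    by (rule strict_mono_on_imp_inj_on[OF u], rule strict_mono_on_imp_inj_on[OF w])
  have s_inj: "s i = s i' \<longleftrightarrow> i = i'" and t_inj: "t i = t i' \<longleftrightarrow> i = i'" for i i'
    by (rule inj_eq[OF permutes_inj[OF s]], rule inj_eq[OF permutes_inj[OF t]])
  define L where "L = map g [1..<Suc (m + n)]"
  have setL: "set L = g ` {1..m + n}" by (auto simp: L_def simp del: upt_Suc)
  have nth: "L ! k = g (Suc k)" if "k < m + n" for k
    using that by (simp add: L_def nth_append del: upt_Suc)
  have "ordering n m L"
    unfolding ordering_def
  proof (intro conjI)
    show "Zero \<notin> set L"
    proof
      assume "Zero \<in> set L"
      then obtain k where "k \<in> {1..m + n}" "Zero = g k" unfolding setL by blast
      then show False using cases[of k] gu gw signed_label_nonzero by metis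
    qed
    have "inj_on (axis_of \<circ> g) {1..m + n}"
    proof (rule inj_onI)
      fix k k' assume k: "k \<in> {1..m + n}" "k' \<in> {1..m + n}" "(axis_of \<circ> g) k = (axis_of \<circ> g) k'"
      from cases[OF k(1)] cases[OF k(2)] show "k = k'"
        by (elim disjE bexE) (use k(3) in \<open>simp_all add: gu gw s_inj t_inj\<close>)
    qed
    then show "distinct (map axis_of L)"
      by (simp add: L_def distinct_map atLeastLessThanSuc_atLeastAtMost del: upt_Suc)
    have "axis_of ` set L = (\<lambda>k. axis_of (g k)) ` (u ` {1..n} \<union> w ` {1..m})"
      unfolding setL cover by (simp add: image_image)
    also have "\<dots> = (\<lambda>i. axis_of (g (u i))) ` {1..n} \<union> (\<lambda>j. axis_of (g (w j))) ` {1..m}"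
      by (simp only: image_Un image_image)
    also have "(\<lambda>i. axis_of (g (u i))) ` {1..n} = (\<lambda>i. Del (s i)) ` {1..n}"
      by (rule image_cong) (simp_all add: gu)
    also have "(\<lambda>j. axis_of (g (w j))) ` {1..m} = (\<lambda>j. Eps (t j)) ` {1..m}"
      by (rule image_cong) (simp_all add: gw)
    also have "(\<lambda>i. Del (s i)) ` {1..n} = Del ` {1..n}"
      using permutes_image[OF s] by (metis image_image)
    also have "(\<lambda>j. Eps (t j)) ` {1..m} = Eps ` {1..m}"
      using permutes_image[OF t] by (metis image_image)
    finally show "axis_of ` set L = axes n m" by (simp add: axes_def)
  qed
  moreover have "length L = m + n" by (simp add: L_def del: upt_Suc)
  moreover have "wt (L ! k) = f (Suc k)" if "k < m + n" for k
  proof -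
    have "Suc k \<in> {1..m + n}" using that by simp
    from cases[OF this] show ?thesis
    proof (elim disjE bexE)
      fix i assume i: "i \<in> {1..n}" "Suc k = u i"
      then show ?thesis unfolding nth[OF that] i(2) gu[OF i(1)] using fu \<xi> wt_signed_label(1) by simp
    next
      fix j assume j: "j \<in> {1..m}" "Suc k = w j"
      then show ?thesis unfolding nth[OF that] j(2) gw[OF j(1)] using fw \<eta> wt_signed_label(2) by simp
    qed
  qed
  moreover have "list_weight l 0 0 L = frob_weight n m u w s t \<xi> \<eta> l"
  proof -
    let ?F = "\<lambda>k. weight_scale (of_int (frob_coeff l (parity_count 0 (map g [1..<k]))
        (parity_count 1 (map g [1..<k])) (g k))) (wt (g k))"
    have count0: "parity_count 0 (map g [1..<k]) = card {i \<in> {1..n}. u i < k}" if "k \<in> {1..m + n}" for k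
    proof -
      have "{j \<in> {1..<k}. parity (g j) = 0} = u ` {i \<in> {1..n}. u i < k}"
      proof (intro equalityI subsetI)
        fix j assume j: "j \<in> {j \<in> {1..<k}. parity (g j) = 0}"
        then have "j \<in> {1..m + n}" using that by auto
        from cases[OF this] show "j \<in> u ` {i \<in> {1..n}. u i < k}"
          using j gw by (elim disjE bexE) auto
      qed (use range gu in auto)
      moreover have "inj_on u {i \<in> {1..n}. u i < k}"
        by (rule inj_on_subset[OF u_inj]) auto
      ultimately show ?thesis unfolding parity_count_map by (simp only: card_image)
    qed
    have count1: "parity_count 1 (map g [1..<k]) = card {j \<in> {1..m}. w j < k}" if "k \<in> {1..m + n}" for k
    proof -
      have "{j \<in> {1..<k}. parity (g j) = 1} = w ` {j \<in> {1..m}. w j < k}"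
      proof (intro equalityI subsetI)
        fix j assume j: "j \<in> {j \<in> {1..<k}. parity (g j) = 1}"
        then have "j \<in> {1..m + n}" using that by auto
        from cases[OF this] show "j \<in> w ` {i \<in> {1..m}. w i < k}"
          using j gu by (elim disjE bexE) auto
      qed (use range' gw in auto)
      moreover have "inj_on w {j \<in> {1..m}. w j < k}"
        by (rule inj_on_subset[OF w_inj]) auto
      ultimately show ?thesis unfolding parity_count_map by (simp only: card_image)
    qed
    \<comment> \<open>Monotonicity of the positions: exactly i - 1 entries of its own kind precede
      the i-th one, so \<open>frob_coeff\<close> reads row or column i.\<close>
    have before: "card {i' \<in> {1..k}. v i' < v i} = i - 1"
      if "strict_mono_on {1..k} v" "i \<in> {1..k}" for v :: "nat \<Rightarrow> nat" and i k
    proof -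
      have "{i' \<in> {1..k}. v i' < v i} = {1..<i}"
        using that strict_mono_on_less[OF that(1)] by auto
      then show ?thesis by simp
    qed
    have Fu: "?F (u i) = weight_scale (of_int (\<xi> i * frob_p m u w l i)) (delta (s i))" if i: "i \<in> {1..n}" for i
    proof -
      have "frob_coeff l (i - 1) (card {j \<in> {1..m}. w j < u i}) (g (u i)) = frob_p m u w l i"
        using i by (simp add: frob_coeff_def frob_p_def gu)
      moreover have "wt (g (u i)) = weight_scale (of_int (\<xi> i)) (delta (s i))"
        using i \<xi> by (simp add: gu wt_signed_label)
      ultimately show ?thesis
        unfolding count0[OF range[OF i]] count1[OF range[OF i]] before[OF u i]
        by (simp add: weight_scale_def fun_eq_iff)
    qed
    have Fw: "?F (w j) = weight_scale (of_int (\<eta> j * frob_q n u w l j)) (eps (t j))" if j: "j \<in> {1..m}" for j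
    proof -
      have "frob_coeff l (card {i \<in> {1..n}. u i < w j}) (j - 1) (g (w j)) = frob_q n u w l j"
        using j by (simp add: frob_coeff_def frob_q_def gw)
      moreover have "wt (g (w j)) = weight_scale (of_int (\<eta> j)) (eps (t j))"
        using j \<eta> by (simp add: gw wt_signed_label)
      ultimately show ?thesis
        unfolding count0[OF range'[OF j]] count1[OF range'[OF j]] before[OF w j]
        by (simp add: weight_scale_def fun_eq_iff)
    qed
    have "list_weight l 0 0 L = (\<Sum>k\<in>u ` {1..n} \<union> w ` {1..m}. ?F k)"
      unfolding L_def list_weight_map cover ..
    also have "\<dots> = (\<Sum>k\<in>u ` {1..n}. ?F k) + (\<Sum>k\<in>w ` {1..m}. ?F k)"
      by (rule sum.union_disjoint) (use disj in auto)
    also have "\<dots> = (\<Sum>i = 1..n. ?F (u i)) + (\<Sum>j = 1..m. ?F (w j))"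
      by (simp only: sum.reindex[OF u_inj] sum.reindex[OF w_inj] o_def)
    also have "\<dots> = frob_weight n m u w s t \<xi> \<eta> l"
      unfolding frob_weight_def
      by (intro arg_cong2[where f = "(+)"] sum.cong refl Fu Fw) simp_all
    finally show ?thesis .
  qed
  ultimately show ?thesis by blast
qed

lemma frob_weight_in_weights:
  assumes s: "s permutes {1..n}" and t: "t permutes {1..m}"
  shows "frob_weight n m u w s t \<xi> \<eta> l \<in> weights n m"
proof -
  have add: "f + g \<in> weights n m" if "f \<in> weights n m" "g \<in> weights n m" for f g
    using that by (simp add: weights_def)
  have sum: "sum h I \<in> weights n m" if "\<And>i. i \<in> I \<Longrightarrow> h i \<in> weights n m" for h and I :: "nat set"
    using that by (induction I rule: infinite_finite_induct) (auto intro: add, auto simp: weights_def)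
  have "weight_scale z (delta (s i)) \<in> weights n m" if "i \<in> {1..n}" for z i
    using permutes_in_image[OF s, of i] that by (auto simp: weights_def weight_scale_def delta_def axes_def)
  moreover have "weight_scale z (eps (t j)) \<in> weights n m" if "j \<in> {1..m}" for z j
    using permutes_in_image[OF t, of j] that by (auto simp: weights_def weight_scale_def eps_def axes_def)
  ultimately show ?thesis unfolding frob_weight_def by (intro add sum)
qed

text \<open>In the standard sequence no epsilon precedes a delta and all n deltas precede each
  epsilon, so the coordinates are the first n rows and the columns below them.\<close>

lemma hook_weight_frob_weight:
  assumes "partition l"
  shows "hook_weight n m l = frob_weight n m (\<lambda>i. i) (\<lambda>j. n + j) id id (\<lambda>_. 1) (\<lambda>_. 1) l"
proof -
  have p: "frob_p m (\<lambda>i. i) (\<lambda>j. n + j) l i = int (l i)" if "i \<in> {1..n}" for i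
  proof -
    have "{j \<in> {1..m}. n + j < i} = {}" using that by auto
    then show ?thesis unfolding frob_p_def by (simp only: card.empty)
  qed
  have q: "frob_q n (\<lambda>i. i) (\<lambda>j. n + j) l j = int (conjugate (\<lambda>k. l (n + k)) j)" if "j \<in> {1..m}" for j
  proof -
    have "{i \<in> {1..n}. i < n + j} = {1..n}" using that by auto
    then have "card {i \<in> {1..n}. i < n + j} = n" by simp
    then show ?thesis using that by (simp add: frob_q_def conjugate_shift[OF assms] max_def)
  qed
  show ?thesis
    unfolding hook_weight_def frob_weight_def
    by (intro arg_cong2[where f = "(+)"] sum.cong refl) (simp_all add: p q)
qed

theorem theorem6p4:
  fixes n m :: nat and l :: "nat \<Rightarrow> nat"
    and Bst B :: "mat set" and f :: "nat \<Rightarrow> weight"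
    and u w s t :: "nat \<Rightarrow> nat" and \<xi> \<eta> :: "nat \<Rightarrow> int"
    and scale :: "complex \<Rightarrow> 'v::ab_group_add \<Rightarrow> 'v"
    and V :: "nat \<Rightarrow> 'v set" and act :: "mat \<Rightarrow> 'v \<Rightarrow> 'v"
  assumes "n \<ge> 1" and "m \<ge> 1"
    and "hook_partition n m l"
    and "borel_subalgebra n m B"
    and "borel_sequence n m B f u w s t \<xi> \<eta>"
    and "standard_borel n m Bst"
    and "irreducible_module scale n m V act"
    and "highest_weight scale n m act Bst (hook_weight n m l)"
  shows "\<forall>\<mu>. highest_weight scale n m act B \<mu> \<longleftrightarrow> \<mu> = frob_weight n m u w s t \<xi> \<eta> l"
proof -
  interpret irreducible_osp_module scale n m V act
    using assms(7) unfolding irreducible_module_def irreducible_osp_module_def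
      irreducible_osp_module_axioms_def by blast
  have l: "partition l" using assms(3) by (simp add: hook_partition_def)
  \<comment> \<open>The sequence of the standard Borel subalgebra: all signs are +1, both
    permutations trivial, positions u i = i and w j = n + j.\<close>
  define f0 where "f0 k = (if k \<le> n then delta k else eps (k - n))" for k
  have id: "weight_scale 1 \<nu> = \<nu>" for \<nu> by (simp add: weight_scale_def)
  have "\<exists>L. ordering n m L \<and> length L = m + n \<and> (\<forall>k<m + n. wt (L ! k) = f0 (Suc k)) \<and>
    list_weight l 0 0 L = frob_weight n m (\<lambda>i. i) (\<lambda>j. n + j) id id (\<lambda>_. 1) (\<lambda>_. 1) l"
  proof (rule sequence_ordering)
    have "(\<lambda>j. n + j) ` {1..m} = {n + 1..n + m}" by simp
    then show "(\<lambda>i. i) ` {1..n} \<inter> (\<lambda>j. n + j) ` {1..m} = {}"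
      "(\<lambda>i. i) ` {1..n} \<union> (\<lambda>j. n + j) ` {1..m} = {1..m + n}" by auto
  qed (auto simp: strict_mono_on_def permutes_id permutes_id[unfolded id_def] f0_def id)
  then obtain K where K: "ordering n m K" "length K = m + n" "\<And>k. k < m + n \<Longrightarrow> wt (K ! k) = f0 (Suc k)"
      "list_weight l 0 0 K = hook_weight n m l"
    using hook_weight_frob_weight[OF l] by metis
  have st: "borel_subalgebra n m Bst"
      "simple_roots n m Bst = {delta i - delta (i + 1) | i. 1 \<le> i \<and> i < n} \<union> {delta n - eps 1} \<union>
       {eps j - eps (j + 1) | j. 1 \<le> j \<and> j < m} \<union> {eps m}"
    using assms(6) by (auto simp: standard_borel_def)
  have st\<delta>: "delta i - delta (i + 1) \<in> simple_roots n m Bst" if "1 \<le> i" "i < n" for i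
    unfolding st(2) using that by (intro UnI1 CollectI exI[of _ i]) simp
  have st\<epsilon>: "eps j - eps (j + 1) \<in> simple_roots n m Bst" if "1 \<le> j" "j < m" for j
    unfolding st(2) using that by (intro UnI1[OF UnI2] CollectI exI[of _ j]) simp
  have st\<delta>\<epsilon>: "delta n - eps 1 \<in> simple_roots n m Bst" "eps m \<in> simple_roots n m Bst"
    unfolding st(2) by simp_all
  have stK: "wt (K ! k) - wt (K ! Suc k) \<in> simple_roots n m Bst" if k: "Suc k < length K" for k
  proof -
    have "wt (K ! k) - wt (K ! Suc k) = f0 (Suc k) - f0 (Suc (Suc k))"
      using K(2) K(3)[of k] K(3)[of "Suc k"] k by simp
    moreover consider "Suc k < n" | "Suc k = n" | j where "Suc k = n + j" "1 \<le> j" "j < m"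
    proof -
      have "Suc k < n \<or> Suc k = n \<or> Suc k = n + (Suc k - n) \<and> 1 \<le> Suc k - n \<and> Suc k - n < m"
        using k K(2) by arith
      then show thesis using that by blast
    qed
    then have "f0 (Suc k) - f0 (Suc (Suc k)) \<in> simple_roots n m Bst"
    proof cases
      case 1
      then show ?thesis using st\<delta>[of "Suc k"] by (simp add: f0_def)
    next
      case 2
      then show ?thesis using st\<delta>\<epsilon>(1) by (simp add: f0_def)
    next
      case (3 j)
      then show ?thesis using st\<epsilon>[of j] by (simp add: f0_def)
    qed
    ultimately show ?thesis by simp
  qed
  have "K \<noteq> []" using K(2) assms(1) by auto
  then have "wt (last K) = eps m"
    using K(2) K(3)[of "m + n - 1"] assms(1,2) by (simp add: last_conv_nth f0_def)
  then have stK': "wt (last K) \<in> simple_roots n m Bst" using st\<delta>\<epsilon>(2) by simp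
  \<comment> \<open>The hypothesis on the standard Borel subalgebra supplies the starting vector of
    the chain.\<close>
  have "\<exists>v. v \<noteq> 0 \<and> weight_vector (hook_weight n m l) v \<and> singular (height K) v"
    using assms(8) highest_weight_iff[OF st(1) K(1) stK stK'] by simp
  then obtain v where v: "v \<noteq> 0" "weight_vector (hook_weight n m l) v" "singular (height K) v"
    by (elim exE conjE)
  have "extremal l K"
    using homogeneous_singular[OF v(1,3,2)] K(1) unfolding extremal_def K(4) by fast
  note bs = assms(5)[unfolded borel_sequence_def]
  have "\<exists>L. ordering n m L \<and> length L = m + n \<and> (\<forall>k<m + n. wt (L ! k) = f (Suc k)) \<and>
    list_weight l 0 0 L = frob_weight n m u w s t \<xi> \<eta> l"
    using bs by (elim conjE) (rule sequence_ordering; assumption)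
  then obtain L where L: "ordering n m L" "length L = m + n" "\<And>k. k < m + n \<Longrightarrow> wt (L ! k) = f (Suc k)"
      "list_weight l 0 0 L = frob_weight n m u w s t \<xi> \<eta> l"
    by blast
  have simple: "simple_roots n m B = {f k - f (k + 1) | k. 1 \<le> k \<and> k < m + n} \<union> {f (m + n)}"
    using bs by (elim conjE)
  have "wt (L ! k) - wt (L ! Suc k) \<in> simple_roots n m B" if k: "Suc k < length L" for k
  proof -
    have "wt (L ! k) - wt (L ! Suc k) = f (Suc k) - f (Suc k + 1)"
      using L(2) L(3)[of k] L(3)[of "Suc k"] k by simp
    then show ?thesis using k L(2) unfolding simple by (intro UnI1) (intro CollectI exI[of _ "Suc k"], simp)
  qed
  moreover have "wt (last L) \<in> simple_roots n m B"
  proof -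
    have "L \<noteq> []" using L(2) assms(1) by auto
    then have "wt (last L) = f (m + n)"
      using L(2) L(3)[of "m + n - 1"] assms(1) by (simp add: last_conv_nth)
    then show ?thesis unfolding simple by simp
  qed
  moreover have "extremal l L" by (rule extremal_independent[OF l K(1) L(1) \<open>extremal l K\<close>])
  moreover have "list_weight l 0 0 L \<in> weights n m"
    unfolding L(4) using bs by (elim conjE) (rule frob_weight_in_weights; assumption)
  ultimately show ?thesis
    unfolding L(4)[symmetric] by (intro allI highest_weight_extremal[OF assms(4) L(1)])
qed

end
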